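(* Let $\Omega$ be a convex, causally convex domain in $\mathbf{R}^{1,n}$. Assume that $\Omega$ is contained between two spacelike hyperplanes. Let $\tau^-$ and $\tau^+$ be the associated past and future cosmological time functions. Then $$\frac12\,\hat d_{\ln(\tau^-/\tau^+)}\le\delta_\Omega\le 2\,\hat d_{\ln(\tau^-/\tau^+)}.$$
   Context: Minkowski space: $\mathbf{R}^{1,n}$ ($n\ge 1$) is $\mathbf{R}\times\mathbf{R}^n$ with coordinates $(t,p)$, flat metric $\mathbf{b}=-dt^2+dp_1^2+\dots+dp_n^2$ and time orientation $\partial_t$. A nonzero vector $v$ is lightlike if $\mathbf{b}(v,v)=0$, causal if $\mathbf{b}(v,v)\le 0$, and a causal vector is future if $\mathbf{b}(v,\partial_t)<0$; a future causal curve is a piecewise smooth curve with future causal velocity. Write $x\le y$ if $x=y$ or there is a future causal curve from $x$ to $y$; $J^+(x)=\{y:x\le y\}$, $J^-(x)=\{y:y\le x\}$. A domain is a nonempty, connected, proper open subset of $\mathbf{R}^{1,n}$. A domain $\Omega$ is causally convex if every causal curve of $\mathbf{R}^{1,n}$ with endpoints in $\Omega$ is contained in $\Omega$. A hyperplane is spacelike if $\mathbf{b}$ is positive definite on its direction; "contained between two spacelike hyperplanes" means contained in the future of one and in the past of the other. Cosmological times: for $x\le y$ let $\mathcal{T}(x,y)=\mathcal{T}(y,x)=\sqrt{|\mathbf{b}(y-x,y-x)|}$; $\tau^\pm(x)=\sup\{\mathcal{T}(x,y): y\in\Omega\cap J^\pm(x)\}$. Null distance: for a time function $T:\Omega\to\mathbf{R}$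 (continuous and strictly increasing along future causal curves), $\hat d_T(x,y)=\inf\sum_{k=1}^{m-1}|T(x_{k+1})-T(x_k)|$, the infimum over all finite sequences $x_1=x,\dots,x_m=y$ in $\Omega$ such that $x_k$ and $x_{k+1}$ are causally related for all $k$. Markowitz pseudodistance: let $I=(-1,1)$ and $\rho_I(s,t)=\left|\ln\frac{(s-1)(t+1)}{(s+1)(t-1)}\right|$. For a domain $\Omega$, a projectively parametrized lightlike geodesic of $\Omega$ is a curve $\gamma:I\to\Omega$, $\gamma(s)=x+h(s)v$, with $v$ lightlike and $h$ a (nonconstant) real homography without pole in $I$. Then $\delta_\Omega(x,y)=\inf\sum_{k=1}^m\rho_I(s_k,t_k)$, the infimum being over all finite families of such geodesics $\gamma_1,\dots,\gamma_m$ and points $s_k,t_k\in I$ with $\gamma_1(s_1)=x$, $\gamma_m(t_m)=y$, $\gamma_k(t_k)=\gamma_{k+1}(s_{k+1})$. *)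

theory Defs
  imports "HOL-Analysis.Analysis"
begin

section \<open>Minkowski space\<close>

text \<open>The first component is the time coordinate \<open>t\<close>. As every type is nonempty, \<open>CARD('n) \<ge> 1\<close>.\<close>

type_synonym 'n minkowski = "real \<times> (real ^ 'n)"

definition mink :: "'n::finite minkowski \<Rightarrow> 'n minkowski \<Rightarrow> real" where
  "mink v w = - (fst v * fst w) + snd v \<bullet> snd w"

definition dt_vec :: "'n::finite minkowski" where
  "dt_vec = (1, 0)"

definition lightlike :: "'n::finite minkowski \<Rightarrow> bool" where
  "lightlike v \<longleftrightarrow> v \<noteq> 0 \<and> mink v v = 0"

definition causal_vec :: "'n::finite minkowski \<Rightarrow> bool" where
  "causal_vec v \<longleftrightarrow> v \<noteq> 0 \<and> mink v v \<le> 0"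

definition future_causal_vec :: "'n::finite minkowski \<Rightarrow> bool" where
  "future_causal_vec v \<longleftrightarrow> causal_vec v \<and> mink v dt_vec < 0"

section \<open>Causality\<close>

text \<open>\<open>c\<close> is smooth on \<open>[a, b]\<close> (one-sided derivatives at the endpoints), with \<open>c'\<close> as its
  velocity: \<open>D k\<close> is the derivative of order \<open>k\<close>.\<close>

definition smooth_arc ::
    "(real \<Rightarrow> 'a::real_normed_vector) \<Rightarrow> (real \<Rightarrow> 'a) \<Rightarrow> real \<Rightarrow> real \<Rightarrow> bool" where
  "smooth_arc c c' a b \<longleftrightarrow>
     (\<exists>D. D 0 = c \<and> D 1 = c' \<and>
       (\<forall>k::nat. \<forall>s\<in>{a..b}. (D k has_vector_derivative D (Suc k) s) (at s within {a..b})))"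

text \<open>Piecewise smooth curves \<open>[a, b] \<rightarrow> 'a\<close> all of whose velocities lie in \<open>V\<close>; both one-sided
  velocities are considered at the break points. Continuity at the break points is automatic.\<close>

definition piecewise_smooth_curve ::
    "'a::real_normed_vector set \<Rightarrow> (real \<Rightarrow> 'a) \<Rightarrow> real \<Rightarrow> real \<Rightarrow> bool" where
  "piecewise_smooth_curve V c a b \<longleftrightarrow>
     (\<exists>(N::nat) (r::nat \<Rightarrow> real). N \<ge> 1 \<and> r 0 = a \<and> r N = b \<and>
       (\<forall>i<N. r i < r (Suc i) \<and>
         (\<exists>c'. smooth_arc c c' (r i) (r (Suc i)) \<and> c' ` {r i..r (Suc i)} \<subseteq> V)))"

definition future_causal_curve :: "(real \<Rightarrow> 'n::finite minkowski) \<Rightarrow> real \<Rightarrow> real \<Rightarrow> bool" where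
  "future_causal_curve c a b \<longleftrightarrow> piecewise_smooth_curve {v. future_causal_vec v} c a b"

definition past_causal_curve :: "(real \<Rightarrow> 'n::finite minkowski) \<Rightarrow> real \<Rightarrow> real \<Rightarrow> bool" where
  "past_causal_curve c a b \<longleftrightarrow> piecewise_smooth_curve {v. future_causal_vec (- v)} c a b"

text \<open>A causal curve has a constant time orientation: it does not switch between future and past
  at its break points.\<close>

definition causal_curve :: "(real \<Rightarrow> 'n::finite minkowski) \<Rightarrow> real \<Rightarrow> real \<Rightarrow> bool" where
  "causal_curve c a b \<longleftrightarrow> future_causal_curve c a b \<or> past_causal_curve c a b"

definition causal_le :: "'n::finite minkowski \<Rightarrow> 'n minkowski \<Rightarrow> bool" where
  "causal_le x y \<longleftrightarrow> x = y \<or> (\<exists>c a b. future_causal_curve c a b \<and> c a = x \<and> c b = y)"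

definition J_plus :: "'n::finite minkowski \<Rightarrow> 'n minkowski set" where
  "J_plus x = {y. causal_le x y}"

definition J_minus :: "'n::finite minkowski \<Rightarrow> 'n minkowski set" where
  "J_minus x = {y. causal_le y x}"

definition mink_domain :: "'n::finite minkowski set \<Rightarrow> bool" where
  "mink_domain \<Omega> \<longleftrightarrow> \<Omega> \<noteq> {} \<and> connected \<Omega> \<and> \<Omega> \<noteq> UNIV \<and> open \<Omega>"

definition causally_convex :: "'n::finite minkowski set \<Rightarrow> bool" where
  "causally_convex \<Omega> \<longleftrightarrow>
     (\<forall>c a b. causal_curve c a b \<and> c a \<in> \<Omega> \<and> c b \<in> \<Omega> \<longrightarrow> c ` {a..b} \<subseteq> \<Omega>)"

definition spacelike_hyperplane :: "'n::finite minkowski set \<Rightarrow> bool" where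
  "spacelike_hyperplane H \<longleftrightarrow>
     (\<exists>a c. a \<noteq> 0 \<and> H = {x. a \<bullet> x = c}) \<and>
     (\<forall>v \<in> {x - y | x y. x \<in> H \<and> y \<in> H}. v \<noteq> 0 \<longrightarrow> mink v v > 0)"

definition between_spacelike_hyperplanes :: "'n::finite minkowski set \<Rightarrow> bool" where
  "between_spacelike_hyperplanes \<Omega> \<longleftrightarrow>
     (\<exists>H1 H2. spacelike_hyperplane H1 \<and> spacelike_hyperplane H2 \<and>
        \<Omega> \<subseteq> (\<Union>x\<in>H1. J_plus x) \<and> \<Omega> \<subseteq> (\<Union>x\<in>H2. J_minus x))"

section \<open>Cosmological times and null distance\<close>

text \<open>The suprema and infima below are taken in \<^typ>\<open>real\<close>. They range over nonempty sets that are
  bounded on the relevant side when \<open>\<Omega>\<close> is a domain contained between two spacelike hyperplanes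
  and the points lie in \<open>\<Omega>\<close>; elsewhere the values are irrelevant.\<close>

definition lorentz_sep :: "'n::finite minkowski \<Rightarrow> 'n minkowski \<Rightarrow> real" where
  "lorentz_sep x y = sqrt \<bar>mink (y - x) (y - x)\<bar>"

definition tau_plus :: "'n::finite minkowski set \<Rightarrow> 'n minkowski \<Rightarrow> real" where
  "tau_plus \<Omega> x = (SUP y \<in> \<Omega> \<inter> J_plus x. lorentz_sep x y)"

definition tau_minus :: "'n::finite minkowski set \<Rightarrow> 'n minkowski \<Rightarrow> real" where
  "tau_minus \<Omega> x = (SUP y \<in> \<Omega> \<inter> J_minus x. lorentz_sep x y)"

definition null_distance ::
    "'n::finite minkowski set \<Rightarrow> ('n minkowski \<Rightarrow> real) \<Rightarrow> 'n minkowski \<Rightarrow> 'n minkowski \<Rightarrow> real" where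
  "null_distance \<Omega> T x y =
     Inf {(\<Sum>k\<in>{1..<m}. \<bar>T (p (k + 1)) - T (p k)\<bar>) | (m::nat) (p::nat \<Rightarrow> 'n minkowski).
            m \<ge> 1 \<and> p 1 = x \<and> p m = y \<and> (\<forall>k\<in>{1..m}. p k \<in> \<Omega>) \<and>
            (\<forall>k\<in>{1..<m}. causal_le (p k) (p (k + 1)) \<or> causal_le (p (k + 1)) (p k))}"

section \<open>Markowitz pseudodistance\<close>

abbreviation unit_I :: "real set" where
  "unit_I \<equiv> {-1<..<1}"

definition rho_I :: "real \<Rightarrow> real \<Rightarrow> real" where
  "rho_I s t = \<bar>ln (((s - 1) * (t + 1)) / ((s + 1) * (t - 1)))\<bar>"

definition homography_on :: "real set \<Rightarrow> (real \<Rightarrow> real) \<Rightarrow> bool" where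
  "homography_on I h \<longleftrightarrow>
     (\<exists>\<alpha> \<beta> \<gamma> \<delta>. \<alpha> * \<delta> - \<beta> * \<gamma> \<noteq> 0 \<and>
        (\<forall>s\<in>I. \<gamma> * s + \<delta> \<noteq> 0 \<and> h s = (\<alpha> * s + \<beta>) / (\<gamma> * s + \<delta>)))"

definition proj_lightlike_geodesic ::
    "'n::finite minkowski set \<Rightarrow> (real \<Rightarrow> 'n minkowski) \<Rightarrow> bool" where
  "proj_lightlike_geodesic \<Omega> g \<longleftrightarrow>
     (\<exists>x v h. lightlike v \<and> homography_on unit_I h \<and>
        (\<forall>s\<in>unit_I. g s = x + h s *\<^sub>R v \<and> g s \<in> \<Omega>))"

definition markowitz_dist ::
    "'n::finite minkowski set \<Rightarrow> 'n minkowski \<Rightarrow> 'n minkowski \<Rightarrow> real" where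
  "markowitz_dist \<Omega> x y =
     Inf {(\<Sum>k\<in>{1..m}. rho_I (s k) (t k)) |
            (m::nat) (g::nat \<Rightarrow> real \<Rightarrow> 'n minkowski) (s::nat \<Rightarrow> real) (t::nat \<Rightarrow> real).
            m \<ge> 1 \<and>
            (\<forall>k\<in>{1..m}. proj_lightlike_geodesic \<Omega> (g k) \<and> s k \<in> unit_I \<and> t k \<in> unit_I) \<and>
            g 1 (s 1) = x \<and> g m (t m) = y \<and>
            (\<forall>k\<in>{1..<m}. g k (t k) = g (k + 1) (s (k + 1)))}"

end

theory Submission imports Defs begin

text \<open>Both inequalities reduce to lightlike segments, on which \<open>\<delta>\<close> is the Hilbert length
  \<open>ln ((y - a) / (x - a)) + ln ((b - x) / (b - y))\<close> of the maximal lightlike segment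
  \<open>(a, b)\<close>. Convexity of \<open>\<Omega>\<close> makes \<open>\<tau>\<^sup>\<plusminus>\<close> star-concave, whence
  \<open>\<tau>\<^sup>-(y) / \<tau>\<^sup>-(x) \<le> (y - a) / (x - a)\<close> and its time dual; this is the lower bound, even
  without the factor \<open>1/2\<close>. Causal convexity forbids that \<open>a\<close> is timelike related to a point of
  \<open>\<Omega>\<close> in the past of \<open>x\<close>, and expanding the quadratic form along the segment then gives
  \<open>(\<tau>\<^sup>-(y) / \<tau>\<^sup>-(x))\<^sup>2 \<ge> (y - a) / (x - a)\<close>. As a causal vector is a sum of two lightlike ones,
  this is the upper bound.\<close>

section \<open>The causal cone\<close>

text \<open>The apex is included, so that the reflexive relation \<open>causal_le\<close> becomes
  membership of the difference in \<open>fcone\<close>.\<close>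

definition fcone :: "'n::finite minkowski set" where
  "fcone = {v. norm (snd v) \<le> fst v}"

lemma mink_self: "mink v v = (norm (snd v))\<^sup>2 - (fst v)\<^sup>2"
  unfolding power2_norm_eq_inner by (simp add: mink_def power2_eq_square)

lemma mink_le_0_iff: "mink v v \<le> 0 \<longleftrightarrow> norm (snd v) \<le> \<bar>fst v\<bar>"
  by (metis abs_norm_cancel abs_le_square_iff diff_le_0_iff_le mink_self)

lemma mink_less_0_iff: "mink v v < 0 \<longleftrightarrow> norm (snd v) < \<bar>fst v\<bar>"
  using abs_le_square_iff[of "fst v" "norm (snd v)"] by (auto simp: mink_self not_le[symmetric])

lemma mink_eq_0_iff: "mink v v = 0 \<longleftrightarrow> norm (snd v) = \<bar>fst v\<bar>"
  using mink_le_0_iff[of v] mink_less_0_iff[of v] by linarith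

lemma fcone_0 [simp]: "0 \<in> fcone"
  by (simp add: fcone_def)

lemma fcone_add: "v \<in> fcone \<Longrightarrow> w \<in> fcone \<Longrightarrow> v + w \<in> fcone"
  using norm_triangle_ineq[of "snd v" "snd w"] by (simp add: fcone_def)

lemma fcone_scale: "v \<in> fcone \<Longrightarrow> 0 \<le> r \<Longrightarrow> r *\<^sub>R v \<in> fcone"
  by (simp add: fcone_def mult_left_mono)

lemma future_causal_vec_iff: "future_causal_vec v \<longleftrightarrow> v \<noteq> 0 \<and> v \<in> fcone"
proof -
  have "v \<noteq> 0 \<and> norm (snd v) \<le> fst v \<longleftrightarrow> v \<noteq> 0 \<and> norm (snd v) \<le> \<bar>fst v\<bar> \<and> 0 < fst v"
  proof (cases "fst v = 0")
    case False
    then show ?thesis using norm_ge_zero[of "snd v"] by linarith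
  qed (auto simp: prod_eq_iff)
  then show ?thesis
    unfolding future_causal_vec_def causal_vec_def mink_le_0_iff fcone_def
    by (simp add: mink_def dt_vec_def)
qed

lemma lightlike_fcone_cases:
  assumes "lightlike v" shows "v \<in> fcone \<or> - v \<in> fcone"
  using assms by (auto simp: lightlike_def mink_eq_0_iff fcone_def)

section \<open>Causal curves and the order they generate\<close>

lemma smooth_arc_affine:
  assumes "\<And>s. s \<in> {a..b} \<Longrightarrow> c s = u + (s - e) *\<^sub>R w"
  shows "smooth_arc c (\<lambda>_. w) a b"
  unfolding smooth_arc_def
proof (intro exI[of _ "\<lambda>k. if k = 0 then c else if k = 1 then (\<lambda>_. w) else (\<lambda>_. 0)"] conjI allI ballI)
  fix k :: nat and s assume s: "s \<in> {a..b}"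
  have "((\<lambda>s. u + (s - e) *\<^sub>R w) has_vector_derivative w) (at s within {a..b})"
    by (auto intro!: derivative_eq_intros)
  then have "(c has_vector_derivative w) (at s within {a..b})"
    by (rule has_vector_derivative_transform[OF s, rotated]) (simp add: assms)
  then show "((if k = 0 then c else if k = 1 then (\<lambda>_. w) else (\<lambda>_. 0)) has_vector_derivative
      (if Suc k = 0 then c else if Suc k = 1 then (\<lambda>_. w) else (\<lambda>_. 0)) s) (at s within {a..b})"
    by auto
qed auto

text \<open>A linear functional that is nonnegative on \<open>fcone\<close> is nondecreasing along
  the arc, and one functional adapted to the total displacement already detects membership in the
  cone.\<close>

lemma smooth_arc_fcone:
  assumes "smooth_arc c c' a b" "a < b" "c' ` {a..b} \<subseteq> fcone"
  shows "c b - c a \<in> fcone"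
proof -
  \<comment> \<open>The direction of the spatial displacement: there \<open>f\<close> equals the
    time component minus the spatial norm. As \<open>sgn 0 = 0\<close>, a purely temporal
    displacement needs no other functional.\<close>
  define e where "e = sgn (snd (c b - c a))"
  define f where "f = (\<lambda>v::'a minkowski. fst v - e \<bullet> snd v)"
  have bl: "bounded_linear f"
    unfolding f_def
    by (intro bounded_linear_sub bounded_linear_fst
        bounded_linear_compose[OF bounded_linear_inner_right bounded_linear_snd])
  have f0: "f v \<ge> 0" if "v \<in> fcone" for v
  proof -
    have "norm e \<le> 1" by (simp add: e_def norm_sgn)
    then have "e \<bullet> snd v \<le> norm (snd v)"
      using norm_cauchy_schwarz[of e "snd v"] mult_right_mono[of "norm e" 1 "norm (snd v)"] by simp
    then show ?thesis using that by (simp add: f_def fcone_def)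
  qed
  obtain D where D: "D 0 = c" "D 1 = c'"
    "\<forall>k::nat. \<forall>s\<in>{a..b}. (D k has_vector_derivative D (Suc k) s) (at s within {a..b})"
    using assms(1) unfolding smooth_arc_def by blast
  have c: "(c has_vector_derivative c' s) (at s within {a..b})" if "s \<in> {a..b}" for s
    using D(3)[rule_format, of s 0] that D(1,2) by simp
  have fc: "((\<lambda>s. f (c s)) has_field_derivative f (c' s)) (at s within {a..b})"
    if "s \<in> {a..b}" for s
    using bounded_linear.has_vector_derivative[OF bl c[OF that]]
    by (simp add: has_real_derivative_iff_has_vector_derivative)
  have cont: "continuous_on {a..b} (\<lambda>s. f (c s))"
    using fc by (rule DERIV_continuous_on)
  have "f (c a) \<le> f (c b)"
  proof (rule DERIV_nonneg_imp_increasing_open[OF _ _ cont])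
    fix s assume s: "a < s" "s < b"
    have "((\<lambda>s. f (c s)) has_real_derivative f (c' s)) (at s)"
      using fc[of s] s by (simp add: at_within_Icc_at)
    moreover have "f (c' s) \<ge> 0" using assms(3) s by (intro f0) auto
    ultimately show "\<exists>y. ((\<lambda>s. f (c s)) has_real_derivative y) (at s) \<and> 0 \<le> y" by blast
  qed (use assms in auto)
  then have "0 \<le> f (c b - c a)"
    by (simp add: f_def inner_diff_right)
  moreover have "e \<bullet> snd (c b - c a) = norm (snd (c b - c a))"
    unfolding e_def sgn_div_norm inner_scaleR_left power2_norm_eq_inner[symmetric]
    by (cases "snd (c b - c a) = 0") (simp_all add: power2_eq_square del: snd_diff)
  ultimately show ?thesis by (simp add: f_def fcone_def)
qed

lemma piecewise_smooth_curve_fcone: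
  assumes "piecewise_smooth_curve V c a b" "V \<subseteq> fcone"
  shows "c b - c a \<in> fcone"
proof -
  obtain N r where N: "r 0 = a" "r (N::nat) = b"
    "\<And>i. i < N \<Longrightarrow> r i < r (Suc i) \<and>
      (\<exists>c'. smooth_arc c c' (r i) (r (Suc i)) \<and> c' ` {r i..r (Suc i)} \<subseteq> V)"
    using assms(1) unfolding piecewise_smooth_curve_def by blast
  have "i \<le> N \<Longrightarrow> c (r i) - c (r 0) \<in> fcone" for i
  proof (induction i)
    case (Suc i)
    then obtain c' where "smooth_arc c c' (r i) (r (Suc i))" "c' ` {r i..r (Suc i)} \<subseteq> V"
      "r i < r (Suc i)" using N(3)[of i] by auto
    then have "c (r (Suc i)) - c (r i) \<in> fcone"
      using smooth_arc_fcone assms(2) by blast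
    from fcone_add[OF this Suc.IH] Suc.prems show ?case by simp
  qed simp
  then show ?thesis using N by blast
qed

text \<open>The break point \<open>z\<close> is free: the midpoint of a segment yields
  \<open>causal_le_iff\<close>, and an arbitrary point between \<open>x\<close> and \<open>y\<close>
  turns causal convexity into \<open>diamond\<close>.\<close>

lemma future_causal_curve_broken_line:
  fixes x z y :: "'n::finite minkowski"
  assumes "x \<noteq> z" "z \<noteq> y" "z - x \<in> fcone" "y - z \<in> fcone"
  shows "future_causal_curve (\<lambda>s. if s \<le> 1 then x + s *\<^sub>R (z - x) else z + (s - 1) *\<^sub>R (y - z)) 0 2"
    (is "future_causal_curve ?c 0 2")
proof -
  have "smooth_arc ?c (\<lambda>_. z - x) 0 1"
    by (rule smooth_arc_affine[of _ _ _ x 0]) simp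
  moreover have "smooth_arc ?c (\<lambda>_. y - z) 1 2"
    by (rule smooth_arc_affine[of _ _ _ z 1]) auto
  moreover have "(\<lambda>_. z - x) ` {0..1::real} \<subseteq> {v. future_causal_vec v}"
    "(\<lambda>_. y - z) ` {1..2::real} \<subseteq> {v. future_causal_vec v}"
    using assms by (auto simp: future_causal_vec_iff)
  ultimately have "\<exists>c'. smooth_arc ?c c' 0 1 \<and> c' ` {0..1} \<subseteq> {v. future_causal_vec v}"
    "\<exists>c'. smooth_arc ?c c' 1 2 \<and> c' ` {1..2} \<subseteq> {v. future_causal_vec v}"
    by blast+
  then show ?thesis
    unfolding future_causal_curve_def piecewise_smooth_curve_def
    by (intro exI[of _ "2::nat"] exI[of _ "real :: nat \<Rightarrow> real"]) (simp add: less_2_cases_iff)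
qed

lemma causal_le_iff: "causal_le x y \<longleftrightarrow> y - x \<in> fcone"
proof
  have sub: "{v. future_causal_vec v} \<subseteq> fcone"
    by (auto simp: future_causal_vec_iff)
  assume "causal_le x y"
  then show "y - x \<in> fcone"
    unfolding causal_le_def future_causal_curve_def
    using piecewise_smooth_curve_fcone[OF _ sub] by auto
next
  assume A: "y - x \<in> fcone"
  show "causal_le x y"
  proof (cases "x = y")
    case False
    \<comment> \<open>A straight segment is treated as a broken line that breaks at its
      midpoint.\<close>
    define z where "z = x + (1/2) *\<^sub>R (y - x)"
    have zx: "z - x = (1/2) *\<^sub>R (y - x)" by (simp add: z_def)
    have yz: "y - z = (1/2) *\<^sub>R (y - x)"
      by (simp add: z_def prod_eq_iff vec_eq_iff field_simps)
    have "future_causal_curve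
        (\<lambda>s. if s \<le> 1 then x + s *\<^sub>R (z - x) else z + (s - 1) *\<^sub>R (y - z)) 0 2"
    proof (rule future_causal_curve_broken_line)
      show "x \<noteq> z" using False zx by auto
      show "z \<noteq> y" using False yz by auto
    qed (use A in \<open>auto simp: zx yz intro!: fcone_scale\<close>)
    then show ?thesis
      unfolding causal_le_def
      by (intro disjI2 exI[of _ "0::real"] exI[of _ "2::real"] exI conjI) (assumption | simp)+
  qed (simp add: causal_le_def)
qed

section \<open>Lorentzian separation of causally related points\<close>

lemma lorentz_sep_eq: "lorentz_sep x y = sqrt \<bar>mink (x - y) (x - y)\<bar>"
  unfolding lorentz_sep_def mink_self fst_diff snd_diff
  by (simp only: norm_minus_commute[of "snd y"] power2_commute[of "fst y"])

lemma lorentz_sep_le: "x - y \<in> fcone \<Longrightarrow> lorentz_sep x y \<le> fst x - fst y"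
proof -
  assume A: "x - y \<in> fcone"
  then have "mink (x - y) (x - y) \<le> 0" and "norm (snd (x - y)) \<le> fst (x - y)"
    by (auto simp: mink_le_0_iff fcone_def)
  moreover from this(2) have "0 \<le> fst x - fst y"
    using norm_ge_zero[of "snd (x - y)"] by (simp del: norm_ge_zero)
  moreover have "- mink (x - y) (x - y) \<le> (fst x - fst y)\<^sup>2"
    by (simp add: mink_self)
  ultimately show ?thesis
    unfolding lorentz_sep_eq
    by (intro real_le_lsqrt) auto
qed

lemma lorentz_sep_power2:
  assumes "x - y \<in> fcone"
  shows "(lorentz_sep x y)\<^sup>2 = - mink (x - y) (x - y)"
proof -
  have "mink (x - y) (x - y) \<le> 0" using assms by (auto simp: mink_le_0_iff fcone_def)
  then show ?thesis unfolding lorentz_sep_eq by simp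
qed

section \<open>Cosmological times\<close>

text \<open>The hypotheses on \<open>\<Omega>\<close> in terms of the cone alone: causal convexity
  becomes \<open>diamond\<close>, and the two hyperplanes become bounds on the time elapsed to the
  past and to the future of a point. The list is symmetric under reversal of all signs, so
  statements on \<open>tau_minus\<close> have duals.\<close>

locale causal_slab =
  fixes \<Omega> :: "'n::finite minkowski set"
  assumes open_dom: "open \<Omega>"
    and convex_dom: "convex \<Omega>"
    and diamond: "\<And>x y z. x \<in> \<Omega> \<Longrightarrow> y \<in> \<Omega> \<Longrightarrow> z - x \<in> fcone \<Longrightarrow> y - z \<in> fcone \<Longrightarrow> z \<in> \<Omega>"
    and past_bounded: "\<And>x. x \<in> \<Omega> \<Longrightarrow> \<exists>K. \<forall>y\<in>\<Omega>. x - y \<in> fcone \<longrightarrow> fst x - fst y \<le> K"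
    and future_bounded: "\<And>x. x \<in> \<Omega> \<Longrightarrow> \<exists>K. \<forall>y\<in>\<Omega>. y - x \<in> fcone \<longrightarrow> fst y - fst x \<le> K"
begin

text \<open>Point reflection reverses the causal order: it exchanges the two ends of a diamond and
  the two time bounds.\<close>

lemma causal_slab_uminus: "causal_slab (uminus ` \<Omega>)"
proof
  show "open (uminus ` \<Omega>)" using open_dom by (rule open_negations)
  show "convex (uminus ` \<Omega>)" using convex_dom by (rule convex_negations)
next
  fix x y z assume A: "x \<in> uminus ` \<Omega>" "y \<in> uminus ` \<Omega>" "z - x \<in> fcone" "y - z \<in> fcone"
  then have "- z \<in> \<Omega>" by (intro diamond[of "- y" "- x" "- z"]) auto
  then show "z \<in> uminus ` \<Omega>" by force
next
  fix x assume "x \<in> uminus ` \<Omega>"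
  then have "- x \<in> \<Omega>" by auto
  from future_bounded[OF this] past_bounded[OF this]
  obtain K K' where K: "\<forall>y\<in>\<Omega>. y + x \<in> fcone \<longrightarrow> fst y + fst x \<le> K"
    "\<forall>y\<in>\<Omega>. - x - y \<in> fcone \<longrightarrow> - fst x - fst y \<le> K'" by auto
  have "\<forall>y\<in>uminus ` \<Omega>. x - y \<in> fcone \<longrightarrow> fst x - fst y \<le> K"
    using K(1) by (auto simp: add.commute)
  then show "\<exists>K. \<forall>y\<in>uminus ` \<Omega>. x - y \<in> fcone \<longrightarrow> fst x - fst y \<le> K" by blast
  have "\<forall>y\<in>uminus ` \<Omega>. y - x \<in> fcone \<longrightarrow> fst y - fst x \<le> K'"
    using K(2) by (auto simp: minus_diff_commute)
  then show "\<exists>K. \<forall>y\<in>uminus ` \<Omega>. y - x \<in> fcone \<longrightarrow> fst y - fst x \<le> K" by blast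
qed

lemma bdd_above_lorentz_sep:
  assumes "x \<in> \<Omega>"
  shows "bdd_above (lorentz_sep x ` (\<Omega> \<inter> J_minus x))"
proof -
  obtain K where "\<forall>y\<in>\<Omega>. x - y \<in> fcone \<longrightarrow> fst x - fst y \<le> K"
    using past_bounded[OF assms] by blast
  then have "\<forall>y\<in>\<Omega> \<inter> J_minus x. lorentz_sep x y \<le> K"
    using lorentz_sep_le[of x] by (force simp: J_minus_def causal_le_iff)
  then show ?thesis by (intro bdd_aboveI2) auto
qed

lemma lorentz_sep_le_tau_minus:
  assumes "x \<in> \<Omega>" "y \<in> \<Omega>" "x - y \<in> fcone"
  shows "lorentz_sep x y \<le> tau_minus \<Omega> x"
  unfolding tau_minus_def
  using assms by (intro cSUP_upper bdd_above_lorentz_sep) (auto simp: J_minus_def causal_le_iff)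

lemma tau_minus_le:
  assumes "x \<in> \<Omega>" "\<And>y. y \<in> \<Omega> \<Longrightarrow> x - y \<in> fcone \<Longrightarrow> lorentz_sep x y \<le> B"
  shows "tau_minus \<Omega> x \<le> B"
  unfolding tau_minus_def
proof (rule cSUP_least)
  have "x \<in> \<Omega> \<inter> J_minus x" using assms(1) by (simp add: J_minus_def causal_le_iff)
  then show "\<Omega> \<inter> J_minus x \<noteq> {}" by blast
qed (use assms in \<open>auto simp: J_minus_def causal_le_iff\<close>)

lemma tau_minus_pos:
  assumes "x \<in> \<Omega>" shows "tau_minus \<Omega> x > 0"
proof -
  obtain e where e: "e > 0" "cball x e \<subseteq> \<Omega>"
    using open_dom assms open_contains_cball by blast
  \<comment> \<open>A point straight below \<open>x\<close>, in a ball contained in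
    \<open>\<Omega>\<close>; its separation from \<open>x\<close> is exactly
    \<open>e\<close>.\<close>
  define y where "y = x - (e, 0)"
  have "dist x y = e" using e by (simp add: y_def dist_norm norm_Pair)
  then have "y \<in> \<Omega>" using e by auto
  moreover have "x - y \<in> fcone" using e by (simp add: y_def fcone_def)
  ultimately have "lorentz_sep x y \<le> tau_minus \<Omega> x"
    using assms by (intro lorentz_sep_le_tau_minus)
  moreover have "lorentz_sep x y = e"
    using e by (simp add: y_def lorentz_sep_def mink_self)
  ultimately show ?thesis using e by simp
qed

text \<open>The homothety of ratio \<open>l\<close> centred at \<open>a\<close> maps
  \<open>\<Omega>\<close> into itself by convexity, preserves \<open>fcone\<close> and multiplies
  separations by \<open>l\<close>, so it carries competitors for \<open>y\<close> to competitors for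
  the image of \<open>y\<close>.\<close>

lemma tau_minus_star_concave:
  assumes "a \<in> \<Omega>" "y \<in> \<Omega>" "0 \<le> l" "l \<le> 1"
  shows "l * tau_minus \<Omega> y \<le> tau_minus \<Omega> ((1 - l) *\<^sub>R a + l *\<^sub>R y)"
\<comment> \<open>The argument divides by \<open>l\<close>; for \<open>l = 0\<close> the claim is
  positivity of \<open>tau_minus\<close> at \<open>a\<close>.\<close>
proof (cases "l = 0")
  case True
  then show ?thesis using tau_minus_pos[OF assms(1)] by simp
next
  case False
  then have l: "l > 0" using assms by simp
  define x where "x = (1 - l) *\<^sub>R a + l *\<^sub>R y"
  have x: "x \<in> \<Omega>" unfolding x_def using assms by (intro convexD[OF convex_dom]) auto
  have "tau_minus \<Omega> y \<le> tau_minus \<Omega> x / l"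
  proof (rule tau_minus_le[OF assms(2)])
    fix z assume z: "z \<in> \<Omega>" "y - z \<in> fcone"
    define z' where "z' = (1 - l) *\<^sub>R a + l *\<^sub>R z"
    have z': "z' \<in> \<Omega>" unfolding z'_def using assms z by (intro convexD[OF convex_dom]) auto
    have d: "x - z' = l *\<^sub>R (y - z)" by (simp add: x_def z'_def algebra_simps)
    have "mink (l *\<^sub>R w) (l *\<^sub>R w) = l\<^sup>2 * mink w w" for w :: "'n minkowski"
      by (simp add: mink_self power_mult_distrib right_diff_distrib)
    then have "lorentz_sep x z' = l * lorentz_sep y z"
      unfolding lorentz_sep_eq d using l by (simp add: abs_mult real_sqrt_mult)
    moreover have "lorentz_sep x z' \<le> tau_minus \<Omega> x"
      using z l by (intro lorentz_sep_le_tau_minus x z') (auto simp: d fcone_scale)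
    ultimately show "lorentz_sep y z \<le> tau_minus \<Omega> x / l"
      using l by (simp add: field_simps)
  qed
  then show ?thesis using l by (simp add: x_def field_simps)
qed

text \<open>Suppose the excluded point were timelike related to \<open>z\<close>. In the future of
  \<open>z\<close> it would lie between \<open>z\<close> and \<open>x\<close>, hence in
  \<open>\<Omega>\<close> by \<open>diamond\<close>. In the past of \<open>z\<close>, the lightlike
  vector \<open>s *\<^sub>R v\<close> would be the sum of a causal and a timelike future vector,
  which is timelike.\<close>

lemma mink_boundary_nonneg:
  assumes "x \<in> \<Omega>" "z \<in> \<Omega>" "x - z \<in> fcone" "v \<in> fcone" "mink v v = 0" "0 \<le> s" "x - s *\<^sub>R v \<notin> \<Omega>"
  shows "mink (x - s *\<^sub>R v - z) (x - s *\<^sub>R v - z) \<ge> 0"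
proof (rule ccontr)
  define d where "d = x - s *\<^sub>R v - z"
  assume "\<not> ?thesis"
  then have d: "norm (snd d) < \<bar>fst d\<bar>" by (simp only: not_le mink_less_0_iff d_def)
  show False
  proof (cases "fst d \<ge> 0")
    case True
    then have "x - s *\<^sub>R v - z \<in> fcone" using d by (simp only: fcone_def d_def mem_Collect_eq)
    moreover have "x - (x - s *\<^sub>R v) \<in> fcone" using fcone_scale[OF assms(4,6)] by simp
    ultimately show False using diamond[OF assms(2,1)] assms(7) by blast
  next
    case False
    have sv: "s *\<^sub>R v = (x - z) - d" by (simp add: d_def)
    have "norm (snd (s *\<^sub>R v)) = fst (s *\<^sub>R v)"
      using assms by (auto simp: mink_eq_0_iff fcone_def)
    moreover have "norm (snd (s *\<^sub>R v)) \<le> norm (snd (x - z)) + norm (snd d)"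
      unfolding sv snd_diff[of "x - z"] by (rule norm_triangle_ineq4)
    moreover have "fst (s *\<^sub>R v) = fst (x - z) - fst d" unfolding sv by simp
    moreover have "norm (snd (x - z)) \<le> fst (x - z)" using assms by (simp add: fcone_def)
    ultimately show False using d False by linarith
  qed
qed

text \<open>As \<open>v\<close> is null, the quadratic form at \<open>w + k *\<^sub>R v\<close>,
  with \<open>w = x - z\<close>, is affine in \<open>k\<close>. It is nonnegative at
  \<open>k = -s\<close> by \<open>mink_boundary_nonneg\<close>, which bounds its negative at
  \<open>0\<close> by \<open>s / (s + r)\<close> times its negative at \<open>r\<close>. Taking the
  supremum over \<open>z\<close> finishes.\<close>

lemma tau_minus_growth:
  assumes "x \<in> \<Omega>" "x + r *\<^sub>R v \<in> \<Omega>" "x - s *\<^sub>R v \<notin> \<Omega>" "v \<in> fcone" "mink v v = 0" "0 < s" "0 \<le> r"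
  shows "(s + r) * (tau_minus \<Omega> x)\<^sup>2 \<le> s * (tau_minus \<Omega> (x + r *\<^sub>R v))\<^sup>2"
proof -
  define y where "y = x + r *\<^sub>R v"
  have ty: "tau_minus \<Omega> y > 0" using assms by (intro tau_minus_pos) (simp add: y_def)
  have sr: "s + r > 0" using assms by simp
  have "tau_minus \<Omega> x \<le> sqrt (s / (s + r) * (tau_minus \<Omega> y)\<^sup>2)"
  proof (rule tau_minus_le[OF assms(1)], rule real_le_rsqrt)
    fix z assume z: "z \<in> \<Omega>" "x - z \<in> fcone"
    define w where "w = x - z"
    have yz: "y - z = w + r *\<^sub>R v" by (simp add: y_def w_def)
    have yzc: "y - z \<in> fcone" unfolding yz w_def using z assms by (intro fcone_add fcone_scale)
    have le: "lorentz_sep y z \<le> tau_minus \<Omega> y"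
      using assms z by (intro lorentz_sep_le_tau_minus yzc) (auto simp: y_def)
    have "0 \<le> lorentz_sep y z" by (simp add: lorentz_sep_def)
    then have 1: "- mink (y - z) (y - z) \<le> (tau_minus \<Omega> y)\<^sup>2"
      using power_mono[OF le, of 2] by (simp add: lorentz_sep_power2[OF yzc])
    have exp: "mink (w + k *\<^sub>R v) (w + k *\<^sub>R v) = mink w w + 2 * k * mink v w" for k
    proof -
      have "mink (w + k *\<^sub>R v) (w + k *\<^sub>R v) = mink w w + 2 * k * mink v w + k * k * mink v v"
        by (simp add: mink_def inner_add_left inner_add_right inner_commute algebra_simps)
      then show ?thesis using assms by simp
    qed
    have "x - s *\<^sub>R v - z = w + (- s) *\<^sub>R v" by (simp add: w_def)
    then have "0 \<le> mink w w + 2 * (- s) * mink v w"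
      using mink_boundary_nonneg[OF assms(1) z assms(4,5) _ assms(3)] assms(6) by (simp add: exp del: scaleR_minus_left)
    \<comment> \<open>The factor \<open>r\<close> prepares the elimination of
      \<open>mink v w\<close> against \<open>s\<close> times the expansion at
      \<open>k = r\<close>.\<close>
    then have "r * (2 * s * mink v w) \<le> r * mink w w"
      using assms by (intro mult_left_mono) auto
    then have "(s + r) * - mink w w \<le> s * - mink (y - z) (y - z)"
      unfolding yz exp by (simp add: algebra_simps)
    also have "\<dots> \<le> s * (tau_minus \<Omega> y)\<^sup>2"
      using 1 assms by (intro mult_left_mono) auto
    finally show "(lorentz_sep x z)\<^sup>2 \<le> s / (s + r) * (tau_minus \<Omega> y)\<^sup>2"
      unfolding lorentz_sep_power2[OF z(2)] using sr by (simp add: w_def field_simps)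
  qed
  then have "(tau_minus \<Omega> x)\<^sup>2 \<le> (sqrt (s / (s + r) * (tau_minus \<Omega> y)\<^sup>2))\<^sup>2"
    using tau_minus_pos[OF assms(1)] by (intro power_mono) auto
  also have "\<dots> = s / (s + r) * (tau_minus \<Omega> y)\<^sup>2" using assms sr by simp
  finally show ?thesis using sr by (simp add: y_def field_simps)
qed

section \<open>The future cosmological time by point reflection\<close>

lemma tau_plus_eq: "tau_plus \<Omega> x = tau_minus (uminus ` \<Omega>) (- x)"
proof -
  have "y \<in> J_minus (- x) \<longleftrightarrow> - y \<in> J_plus x" for y
    by (simp add: J_plus_def J_minus_def causal_le_iff minus_diff_commute)
  then have "uminus ` \<Omega> \<inter> J_minus (- x) = uminus ` (\<Omega> \<inter> J_plus x)"
    by auto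
  moreover have "lorentz_sep (- x) (- y) = lorentz_sep x y" for y
    unfolding lorentz_sep_eq[of "- x"] by (simp add: lorentz_sep_def)
  ultimately show ?thesis
    by (simp add: tau_plus_def tau_minus_def image_image)
qed

lemma tau_plus_pos: "x \<in> \<Omega> \<Longrightarrow> tau_plus \<Omega> x > 0"
  unfolding tau_plus_eq by (rule causal_slab.tau_minus_pos[OF causal_slab_uminus]) simp

lemma tau_plus_star_concave:
  assumes "a \<in> \<Omega>" "y \<in> \<Omega>" "0 \<le> l" "l \<le> 1"
  shows "l * tau_plus \<Omega> y \<le> tau_plus \<Omega> ((1 - l) *\<^sub>R a + l *\<^sub>R y)"
proof -
  have "- ((1 - l) *\<^sub>R a + l *\<^sub>R y) = (1 - l) *\<^sub>R (- a) + l *\<^sub>R (- y)"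
    unfolding scaleR_minus_right minus_add_distrib ..
  then show ?thesis
    unfolding tau_plus_eq using assms
    by (simp only:) (intro causal_slab.tau_minus_star_concave[OF causal_slab_uminus] imageI)
qed

lemma tau_plus_growth:
  assumes "y \<in> \<Omega>" "y - r *\<^sub>R v \<in> \<Omega>" "y + s *\<^sub>R v \<notin> \<Omega>" "v \<in> fcone" "mink v v = 0" "0 < s" "0 \<le> r"
  shows "(s + r) * (tau_plus \<Omega> y)\<^sup>2 \<le> s * (tau_plus \<Omega> (y - r *\<^sub>R v))\<^sup>2"
proof -
  have "- y - s *\<^sub>R v \<notin> uminus ` \<Omega>"
  proof
    assume "- y - s *\<^sub>R v \<in> uminus ` \<Omega>"
    then obtain u where u: "u \<in> \<Omega>" "- y - s *\<^sub>R v = - u" by blast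
    have "u = - (- y - s *\<^sub>R v)" unfolding u(2) by simp
    then have "u = y + s *\<^sub>R v" by simp
    then show False using u assms by simp
  qed
  moreover have eq: "- (y - r *\<^sub>R v) = - y + r *\<^sub>R v" by simp
  moreover have "- y + r *\<^sub>R v \<in> uminus ` \<Omega>" unfolding eq[symmetric] using assms(2) by (rule imageI)
  ultimately show ?thesis
    unfolding tau_plus_eq eq using assms
    by (intro causal_slab.tau_minus_growth[OF causal_slab_uminus] imageI)
qed

end

section \<open>Lightlike geodesics and the Markowitz distance\<close>

lemma affine_pos_on_unit_I:
  assumes "\<And>s. s \<in> unit_I \<Longrightarrow> c * s + d \<noteq> 0" "0 < d" "s \<in> unit_I"
  shows "0 < c * s + d"
proof (rule ccontr)
  assume "\<not> ?thesis"
  then have neg: "c * s + d < 0" using assms(1)[OF assms(3)] by simp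
  \<comment> \<open>\<open>u * s\<close> is the zero of the affine function between
    \<open>0\<close>, where its value is \<open>d\<close>, and \<open>s\<close>, where it is
    negative.\<close>
  define u where "u = d / (d - (c * s + d))"
  have u: "0 \<le> u" "u \<le> 1" using neg assms(2) by (auto simp: u_def field_simps)
  then have "\<bar>u * s\<bar> \<le> \<bar>s\<bar>" by (simp add: abs_mult mult_left_le_one_le)
  then have "u * s \<in> unit_I" using assms(3) by auto
  moreover have "c * (u * s) + d = 0"
  proof -
    have "c * s \<noteq> 0" using neg assms(2) by linarith
    then show ?thesis by (simp add: u_def)
  qed
  ultimately show False using assms(1) by blast
qed

text \<open>The denominator has no zero on \<open>unit_I\<close>, so it keeps the sign of its value
  \<open>d\<close> at \<open>0\<close>; if that is negative, all four coefficients are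
  negated.\<close>

lemma proj_lightlike_geodesic_normal_form:
  assumes "proj_lightlike_geodesic \<Omega> g"
  obtains x v a b c d where "lightlike v"
    "\<And>s. s \<in> unit_I \<Longrightarrow> 0 < c * s + d \<and> g s = x + ((a * s + b) / (c * s + d)) *\<^sub>R v \<and> g s \<in> \<Omega>"
proof -
  obtain x v h where h: "lightlike v" "homography_on unit_I h"
    "\<And>s. s \<in> unit_I \<Longrightarrow> g s = x + h s *\<^sub>R v \<and> g s \<in> \<Omega>"
    using assms unfolding proj_lightlike_geodesic_def by blast
  obtain a b c d where H: "\<And>s. s \<in> unit_I \<Longrightarrow> c * s + d \<noteq> 0 \<and> h s = (a * s + b) / (c * s + d)"
    using h(2) unfolding homography_on_def by blast
  show ?thesis
  proof (cases "d > 0")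
    case True
    then have "\<And>s. s \<in> unit_I \<Longrightarrow> 0 < c * s + d" using affine_pos_on_unit_I H by blast
    then show ?thesis using that[of v c d x a b] h H by metis
  next
    case False
    moreover have "d \<noteq> 0" using H[of 0] by simp
    ultimately have "- d > 0" by simp
    then have p: "\<And>s. s \<in> unit_I \<Longrightarrow> 0 < (- c) * s + (- d)"
      using H by (intro affine_pos_on_unit_I[of "- c" "- d"]) (auto simp: add_eq_0_iff)
    have "h s = ((- a) * s + (- b)) / ((- c) * s + (- d))" if "s \<in> unit_I" for s
    proof -
      have "(- a) * s + (- b) = - (a * s + b)" "(- c) * s + (- d) = - (c * s + d)" by simp_all
      then show ?thesis using H[OF that] by (simp only: minus_divide_divide)
    qed
    then show ?thesis using that[of v "- c" "- d" x "- a" "- b"] h p by metis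
  qed
qed

text \<open>Interpolating \<open>g s\<close> between \<open>g u\<close> and \<open>g t\<close> and letting \<open>u\<close> tend to the endpoint \<open>-1\<close>.\<close>

lemma star_concave_along_geodesic:
  fixes f :: "'n::finite minkowski \<Rightarrow> real"
  assumes star: "\<And>p y l. p \<in> \<Omega> \<Longrightarrow> y \<in> \<Omega> \<Longrightarrow> 0 \<le> l \<Longrightarrow> l \<le> 1 \<Longrightarrow>
      l * f y \<le> f ((1 - l) *\<^sub>R p + l *\<^sub>R y)"
    and g: "\<And>s. s \<in> unit_I \<Longrightarrow> 0 < c * s + d \<and> g s = x + ((a * s + b) / (c * s + d)) *\<^sub>R v \<and> g s \<in> \<Omega>"
    and st: "s \<in> unit_I" "t \<in> unit_I" "s < t"
  shows "(s + 1) * (c * t + d) * f (g t) \<le> (t + 1) * (c * s + d) * f (g s)"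
proof -
  have ineq: "(s - u) * (c * t + d) * f (g t) \<le> (t - u) * (c * s + d) * f (g s)"
    if u: "- 1 < u" "u < s" for u
  proof -
    have uI: "u \<in> unit_I" using u st by auto
    have q: "0 < c * u + d" "0 < c * s + d" "0 < c * t + d" using g uI st by auto
    \<comment> \<open>\<open>l\<close> is the barycentric coordinate of \<open>g s\<close> between
      \<open>g u\<close> and \<open>g t\<close>: the denominators of the homography enter as
      weights, and \<open>E\<close> is their normalisation.\<close>
    define E where "E = (t - u) * (c * s + d)"
    define l where "l = (s - u) * (c * t + d) / E"
    have E: "E > 0" using q u st by (simp add: E_def)
    have key: "E - (s - u) * (c * t + d) = (t - s) * (c * u + d)"
      by (simp add: E_def algebra_simps)
    have l0: "0 \<le> l" using q u st E by (simp add: l_def)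
    have l1': "1 - l = (t - s) * (c * u + d) / E"
      using E unfolding key[symmetric] by (simp add: l_def field_simps)
    then have l1: "l \<le> 1" using q u st E by (smt (verit) divide_nonneg_pos mult_nonneg_nonneg)
    have "(1 - l) * ((a * u + b) / (c * u + d)) + l * ((a * t + b) / (c * t + d))
        = ((t - s) * (a * u + b) + (s - u) * (a * t + b)) / E"
      unfolding l1' unfolding l_def add_divide_distrib[of "(t - s) * _"] using q by simp
    also have "(t - s) * (a * u + b) + (s - u) * (a * t + b) = (t - u) * (a * s + b)"
      by (simp add: algebra_simps)
    also have "(t - u) * (a * s + b) / E = (a * s + b) / (c * s + d)"
      using u st by (simp add: E_def)
    finally have hs: "(a * s + b) / (c * s + d) =
        (1 - l) * ((a * u + b) / (c * u + d)) + l * ((a * t + b) / (c * t + d))" ..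
    have "g s = (1 - l) *\<^sub>R g u + l *\<^sub>R g t"
      using g[OF uI] g[OF st(1)] g[OF st(2)] hs
      by (simp add: scaleR_add_left scaleR_add_right scaleR_diff_left)
    then have "l * f (g t) \<le> f (g s)"
      using star[of "g u" "g t" l] g uI st l0 l1 by metis
    then show ?thesis using E by (simp add: l_def E_def field_simps)
  qed
  \<comment> \<open>\<open>g u\<close> has dropped out of \<open>ineq\<close>: both sides are
    polynomial in \<open>u\<close>, and no boundary value of \<open>f\<close> is needed.\<close>
  have "\<forall>\<^sub>F u in at_right (- 1). (s - u) * (c * t + d) * f (g t) \<le> (t - u) * (c * s + d) * f (g s)"
    by (rule eventually_mono[OF eventually_at_right_real[of "-1" s]]) (use st ineq in auto)
  then have "(s - (-1)) * (c * t + d) * f (g t) \<le> (t - (-1)) * (c * s + d) * f (g s)"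
    by (rule tendsto_le[rotated 3])
      (intro tendsto_mult tendsto_diff tendsto_const tendsto_ident_at trivial_limit_at_right_real)+
  then show ?thesis by simp
qed

section \<open>The Hilbert length on \<open>unit_I\<close> and quotients of star-concave
  functions\<close>

lemma rho_I_commute:
  assumes "s \<in> unit_I" "t \<in> unit_I"
  shows "rho_I s t = rho_I t s"
proof -
  have "((s - 1) * (t + 1)) / ((s + 1) * (t - 1)) = inverse (((t - 1) * (s + 1)) / ((t + 1) * (s - 1)))"
    by (simp add: mult.commute)
  then show ?thesis unfolding rho_I_def by (simp add: ln_inverse del: inverse_divide)
qed

text \<open>The cross-ratio splits into one factor for each endpoint of \<open>unit_I\<close>, so
  that each can be compared with a single cosmological time.\<close>

lemma rho_I_eq:
  assumes "s \<in> unit_I" "t \<in> unit_I"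
  shows "rho_I s t = \<bar>ln ((t + 1) / (s + 1)) + ln ((1 - s) / (1 - t))\<bar>"
proof -
  have "ln ((t + 1) / (s + 1)) + ln ((1 - s) / (1 - t)) = ln ((t + 1) / (s + 1) * ((1 - s) / (1 - t)))"
    by (rule ln_mult_pos[symmetric]) (use assms in auto)
  also have "(t + 1) / (s + 1) * ((1 - s) / (1 - t)) = ((s - 1) * (t + 1)) / ((s + 1) * (t - 1))"
    using assms by (simp add: divide_simps) (simp add: algebra_simps)
  finally show ?thesis by (simp add: rho_I_def)
qed

lemma frac_le_frac_iff:
  fixes x w :: real
  assumes "0 < x" "0 < w"
  shows "y / x \<le> z / w \<longleftrightarrow> y * w \<le> z * x"
  using assms by (simp add: field_simps)

text \<open>Star-concavity bounds the growth of one function relative to the endpoint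
  \<open>-1\<close> and the decay of the other relative to \<open>1\<close>. The distortion
  \<open>r\<close> of the homography enters these two bounds inversely and cancels in the
  sum.\<close>

lemma ln_ratio_le_rho_I:
  fixes f1 f2 :: "'n::finite minkowski \<Rightarrow> real"
  assumes star1: "\<And>p y l. p \<in> \<Omega> \<Longrightarrow> y \<in> \<Omega> \<Longrightarrow> 0 \<le> l \<Longrightarrow> l \<le> 1 \<Longrightarrow>
      l * f1 y \<le> f1 ((1 - l) *\<^sub>R p + l *\<^sub>R y)"
    and star2: "\<And>p y l. p \<in> \<Omega> \<Longrightarrow> y \<in> \<Omega> \<Longrightarrow> 0 \<le> l \<Longrightarrow> l \<le> 1 \<Longrightarrow>
      l * f2 y \<le> f2 ((1 - l) *\<^sub>R p + l *\<^sub>R y)"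
    and pos: "\<And>y. y \<in> \<Omega> \<Longrightarrow> 0 < f1 y" "\<And>y. y \<in> \<Omega> \<Longrightarrow> 0 < f2 y"
    and g: "proj_lightlike_geodesic \<Omega> g"
    and st: "s \<in> unit_I" "t \<in> unit_I"
  shows "\<bar>ln (f1 (g t) / f2 (g t)) - ln (f1 (g s) / f2 (g s))\<bar> \<le> rho_I s t"
proof -
  obtain x v a b c d where
    G: "\<And>s. s \<in> unit_I \<Longrightarrow> 0 < c * s + d \<and> g s = x + ((a * s + b) / (c * s + d)) *\<^sub>R v \<and> g s \<in> \<Omega>"
    using proj_lightlike_geodesic_normal_form[OF g] by metis
  \<comment> \<open>Reversing the parameter moves the endpoint \<open>1\<close> to
    \<open>-1\<close>, where \<open>star_concave_along_geodesic\<close> applies.\<close>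
  have rev: "0 < (- c) * s + d \<and> g (- s) = x + (((- a) * s + b) / ((- c) * s + d)) *\<^sub>R v \<and> g (- s) \<in> \<Omega>"
    if "s \<in> unit_I" for s
  proof -
    have "- s \<in> unit_I" using that by simp
    from G[OF this, unfolded mult_minus_right] show ?thesis unfolding mult_minus_left .
  qed
  have main: "ln (f (g t)) - ln (f (g s)) + (ln (k (g s)) - ln (k (g t))) \<le> rho_I s t"
    if fstar: "\<And>p y l. p \<in> \<Omega> \<Longrightarrow> y \<in> \<Omega> \<Longrightarrow> 0 \<le> l \<Longrightarrow> l \<le> 1 \<Longrightarrow>
      l * f y \<le> f ((1 - l) *\<^sub>R p + l *\<^sub>R y)"
    and kstar: "\<And>p y l. p \<in> \<Omega> \<Longrightarrow> y \<in> \<Omega> \<Longrightarrow> 0 \<le> l \<Longrightarrow> l \<le> 1 \<Longrightarrow>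
      l * k y \<le> k ((1 - l) *\<^sub>R p + l *\<^sub>R y)"
    and fpos: "\<And>y. y \<in> \<Omega> \<Longrightarrow> 0 < f y" and kpos: "\<And>y. y \<in> \<Omega> \<Longrightarrow> 0 < k y"
    and st: "s \<in> unit_I" "t \<in> unit_I" "s < t"
    for f k :: "'n minkowski \<Rightarrow> real" and s t
  proof -
    define r where "r = (c * s + d) / (c * t + d)"
    have q: "0 < c * s + d" "0 < c * t + d" and gO: "g s \<in> \<Omega>" "g t \<in> \<Omega>"
      using G[OF st(1)] G[OF st(2)] by blast+
    have r: "r > 0" using q by (simp add: r_def)
    note p = fpos[OF gO(1)] fpos[OF gO(2)] kpos[OF gO(1)] kpos[OF gO(2)]
    have "(s + 1) * (c * t + d) * f (g t) \<le> (t + 1) * (c * s + d) * f (g s)"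
      by (rule star_concave_along_geodesic[OF fstar G st]) auto
    then have "f (g t) / f (g s) \<le> ((t + 1) * (c * s + d)) / ((s + 1) * (c * t + d))"
      using p q st by (subst frac_le_frac_iff) (auto simp: mult.commute)
    then have "f (g t) / f (g s) \<le> (t + 1) / (s + 1) * r"
      by (simp add: r_def)
    then have "ln (f (g t) / f (g s)) \<le> ln ((t + 1) / (s + 1) * r)"
      using p by (intro ln_mono) auto
    then have 1: "ln (f (g t)) - ln (f (g s)) \<le> ln ((t + 1) / (s + 1)) + ln r"
      using p r st by (simp add: ln_div ln_mult)
    have "(- t + 1) * ((- c) * (- s) + d) * k (g (- (- s))) \<le> (- s + 1) * ((- c) * (- t) + d) * k (g (- (- t)))"
      by (rule star_concave_along_geodesic[OF kstar rev, of "- t" "- s"]) (use st in auto)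
    then have "(1 - t) * (c * s + d) * k (g s) \<le> (1 - s) * (c * t + d) * k (g t)" by simp
    then have "k (g s) / k (g t) \<le> ((1 - s) * (c * t + d)) / ((1 - t) * (c * s + d))"
      using p q st by (subst frac_le_frac_iff) (auto simp: mult.commute)
    then have "k (g s) / k (g t) \<le> (1 - s) / (1 - t) / r"
      by (simp add: r_def)
    then have "ln (k (g s) / k (g t)) \<le> ln ((1 - s) / (1 - t) / r)"
      using p by (intro ln_mono) auto
    then have 2: "ln (k (g s)) - ln (k (g t)) \<le> ln ((1 - s) / (1 - t)) - ln r"
      using p r st by (simp add: ln_divide_pos[of "(1 - s) / (1 - t)" r] ln_divide_pos[of "k (g s)"]
          del: divide_divide_eq_left)
    show ?thesis using 1 2 unfolding rho_I_eq[OF st(1,2)] by linarith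
  qed
  \<comment> \<open>\<open>main\<close> is one-sided; exchanging the roles of \<open>f1\<close> and
    \<open>f2\<close> gives the opposite sign, hence the absolute value.\<close>
  have both: "\<bar>ln (f1 (g t) / f2 (g t)) - ln (f1 (g s) / f2 (g s))\<bar> \<le> rho_I s t"
    if st: "s \<in> unit_I" "t \<in> unit_I" "s < t" for s t
  proof -
    have gO: "g s \<in> \<Omega>" "g t \<in> \<Omega>" using G[OF st(1)] G[OF st(2)] by blast+
    note p = pos(1)[OF gO(1)] pos(1)[OF gO(2)] pos(2)[OF gO(1)] pos(2)[OF gO(2)]
    have "ln (f1 (g t)) - ln (f1 (g s)) + (ln (f2 (g s)) - ln (f2 (g t))) \<le> rho_I s t"
      by (rule main) (use star1 star2 pos st in auto)
    moreover have "ln (f2 (g t)) - ln (f2 (g s)) + (ln (f1 (g s)) - ln (f1 (g t))) \<le> rho_I s t"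
      by (rule main) (use star1 star2 pos st in auto)
    ultimately show ?thesis using p by (simp add: ln_div)
  qed
  consider "s < t" | "t < s" | "s = t" by linarith
  then show ?thesis
  proof cases
    case 2
    then show ?thesis using both[of t s] st rho_I_commute[OF st] by (simp add: abs_minus_commute)
  qed (use both[of s t] st in \<open>auto simp: rho_I_def\<close>)
qed

section \<open>Chains of lightlike geodesics and their lengths\<close>

definition markowitz_chain :: "'n::finite minkowski set \<Rightarrow> 'n minkowski \<Rightarrow> 'n minkowski \<Rightarrow> real \<Rightarrow> bool" where
  "markowitz_chain \<Omega> x y L \<longleftrightarrow> (\<exists>(m::nat) g s t. L = (\<Sum>k\<in>{1..m}. rho_I (s k) (t k)) \<and>
     m \<ge> 1 \<and>
     (\<forall>k\<in>{1..m}. proj_lightlike_geodesic \<Omega> (g k) \<and> s k \<in> unit_I \<and> t k \<in> unit_I) \<and>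
     g 1 (s 1) = x \<and> g m (t m) = y \<and>
     (\<forall>k\<in>{1..<m}. g k (t k) = g (k + 1) (s (k + 1))))"

lemma markowitz_dist_eq: "markowitz_dist \<Omega> x y = Inf {L. markowitz_chain \<Omega> x y L}"
  unfolding markowitz_dist_def markowitz_chain_def by simp

lemma markowitz_chain_nonneg: "markowitz_chain \<Omega> x y L \<Longrightarrow> 0 \<le> L"
  unfolding markowitz_chain_def by (auto intro!: sum_nonneg simp: rho_I_def)

lemma markowitz_dist_le: "markowitz_chain \<Omega> x y L \<Longrightarrow> markowitz_dist \<Omega> x y \<le> L"
  unfolding markowitz_dist_eq
  by (rule cInf_lower) (auto intro!: bdd_belowI[of _ 0] dest: markowitz_chain_nonneg)

lemma markowitz_chain_single:
  assumes "proj_lightlike_geodesic \<Omega> g" "s \<in> unit_I" "t \<in> unit_I"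
  shows "markowitz_chain \<Omega> (g s) (g t) (rho_I s t)"
  unfolding markowitz_chain_def
  by (rule exI[of _ 1], rule exI[of _ "\<lambda>_. g"], rule exI[of _ "\<lambda>_. s"], rule exI[of _ "\<lambda>_. t"])
    (use assms in auto)

lemma markowitz_chain_snoc:
  assumes "markowitz_chain \<Omega> x (g s) L" "proj_lightlike_geodesic \<Omega> g" "s \<in> unit_I" "t \<in> unit_I"
  shows "markowitz_chain \<Omega> x (g t) (L + rho_I s t)"
proof -
  obtain m g' s' t' where m: "L = (\<Sum>k\<in>{1..m}. rho_I (s' k) (t' k))" "m \<ge> (1::nat)"
     "\<forall>k\<in>{1..m}. proj_lightlike_geodesic \<Omega> (g' k) \<and> s' k \<in> unit_I \<and> t' k \<in> unit_I"
     "g' 1 (s' 1) = x" "g' m (t' m) = g s"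
     "\<forall>k\<in>{1..<m}. g' k (t' k) = g' (k + 1) (s' (k + 1))"
    using assms(1) unfolding markowitz_chain_def by blast
  have S: "(\<Sum>k\<in>{1..m}. rho_I ((s'(Suc m := s)) k) ((t'(Suc m := t)) k)) = L"
    unfolding m(1) by (rule sum.cong) auto
  show ?thesis
    unfolding markowitz_chain_def
  proof (intro exI conjI)
    show "L + rho_I s t = (\<Sum>k\<in>{1..Suc m}. rho_I ((s'(Suc m := s)) k) ((t'(Suc m := t)) k))"
      using S by simp
    show "\<forall>k\<in>{1..Suc m}. proj_lightlike_geodesic \<Omega> ((g'(Suc m := g)) k) \<and>
        (s'(Suc m := s)) k \<in> unit_I \<and> (t'(Suc m := t)) k \<in> unit_I"
      using m assms by auto
    show "\<forall>k\<in>{1..<Suc m}. (g'(Suc m := g)) k ((t'(Suc m := t)) k) =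
        (g'(Suc m := g)) (k + 1) ((s'(Suc m := s)) (k + 1))"
      using m by (auto simp: less_Suc_eq)
  qed (use m in auto)
qed

section \<open>Null chains\<close>

definition null_chain ::
  "'n::finite minkowski set \<Rightarrow> ('n minkowski \<Rightarrow> real) \<Rightarrow> 'n minkowski \<Rightarrow> 'n minkowski \<Rightarrow> real \<Rightarrow> bool" where
  "null_chain \<Omega> T x y L \<longleftrightarrow> (\<exists>(m::nat) p. L = (\<Sum>k\<in>{1..<m}. \<bar>T (p (k + 1)) - T (p k)\<bar>) \<and>
     m \<ge> 1 \<and> p 1 = x \<and> p m = y \<and> (\<forall>k\<in>{1..m}. p k \<in> \<Omega>) \<and>
     (\<forall>k\<in>{1..<m}. causal_le (p k) (p (k + 1)) \<or> causal_le (p (k + 1)) (p k)))"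

lemma null_distance_eq: "null_distance \<Omega> T x y = Inf {L. null_chain \<Omega> T x y L}"
  unfolding null_distance_def null_chain_def by simp

lemma null_chain_nonneg: "null_chain \<Omega> T x y L \<Longrightarrow> 0 \<le> L"
  unfolding null_chain_def by (auto intro!: sum_nonneg)

lemma null_distance_le: "null_chain \<Omega> T x y L \<Longrightarrow> null_distance \<Omega> T x y \<le> L"
  unfolding null_distance_eq
  by (rule cInf_lower) (auto intro!: bdd_belowI[of _ 0] dest: null_chain_nonneg)

lemma null_chain_refl: "x \<in> \<Omega> \<Longrightarrow> null_chain \<Omega> T x x 0"
  unfolding null_chain_def by (rule exI[of _ 1], rule exI[of _ "\<lambda>_. x"]) auto

lemma null_chain_snoc:
  assumes "null_chain \<Omega> T x y L" "z \<in> \<Omega>" "causal_le y z \<or> causal_le z y"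
  shows "null_chain \<Omega> T x z (L + \<bar>T z - T y\<bar>)"
proof -
  obtain m p where m: "L = (\<Sum>k\<in>{1..<m}. \<bar>T (p (k + 1)) - T (p k)\<bar>)"
    "m \<ge> (1::nat)" "p 1 = x" "p m = y" "\<forall>k\<in>{1..m}. p k \<in> \<Omega>"
    "\<forall>k\<in>{1..<m}. causal_le (p k) (p (k + 1)) \<or> causal_le (p (k + 1)) (p k)"
    using assms(1) unfolding null_chain_def by blast
  have S: "(\<Sum>k\<in>{1..<m}. \<bar>T ((p(Suc m := z)) (k + 1)) - T ((p(Suc m := z)) k)\<bar>) = L"
    unfolding m(1) by (rule sum.cong) auto
  show ?thesis
    unfolding null_chain_def
  proof (intro exI conjI)
    show "L + \<bar>T z - T y\<bar> =
        (\<Sum>k\<in>{1..<Suc m}. \<bar>T ((p(Suc m := z)) (k + 1)) - T ((p(Suc m := z)) k)\<bar>)"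
      using S m by simp
    show "\<forall>k\<in>{1..<Suc m}. causal_le ((p(Suc m := z)) k) ((p(Suc m := z)) (k + 1)) \<or>
        causal_le ((p(Suc m := z)) (k + 1)) ((p(Suc m := z)) k)"
      using m assms by (auto simp: less_Suc_eq)
  qed (use m assms in auto)
qed

text \<open>Replaces the indexed encoding by induction on the last point, the first one being fixed,
  so that chains can be converted step by step.\<close>

lemma null_chain_induct [consumes 1, case_names refl snoc]:
  assumes "null_chain \<Omega> T x y L"
    and refl: "x \<in> \<Omega> \<Longrightarrow> P x 0"
    and snoc: "\<And>y z L. P y L \<Longrightarrow> y \<in> \<Omega> \<Longrightarrow> z \<in> \<Omega> \<Longrightarrow> causal_le y z \<or> causal_le z y \<Longrightarrow>
      P z (L + \<bar>T z - T y\<bar>)"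
  shows "P y L"
proof -
  obtain m p where m: "L = (\<Sum>k\<in>{1..<m}. \<bar>T (p (k + 1)) - T (p k)\<bar>)"
    "m \<ge> (1::nat)" "p 1 = x" "p m = y" "\<forall>k\<in>{1..m}. p k \<in> \<Omega>"
    "\<forall>k\<in>{1..<m}. causal_le (p k) (p (k + 1)) \<or> causal_le (p (k + 1)) (p k)"
    using assms(1) unfolding null_chain_def by blast
  have "j \<ge> 1 \<Longrightarrow> j \<le> m \<Longrightarrow> P (p j) (\<Sum>k\<in>{1..<j}. \<bar>T (p (k + 1)) - T (p k)\<bar>)" for j
  proof (induction j)
    case (Suc j)
    show ?case
    \<comment> \<open>Indices start at 1, so the chain with a single point is the case
      \<open>j = 0\<close> of the successor step.\<close>
    proof (cases "j = 0")
      case True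
      have "x \<in> \<Omega>" using m(2,3,5) by force
      then show ?thesis using True m(3) refl by simp
    next
      case False
      then show ?thesis
        using Suc m snoc[of "p j" _ "p (Suc j)"] by simp
    qed
  qed simp
  from this[of m] show ?thesis using m(1,2,4) by simp
qed

text \<open>A small ball lies in the past of a common point of \<open>\<Omega>\<close> above its
  centre, so nearby points are joined by two causal steps, and connectedness makes this global. It
  ensures that the infima range over nonempty sets.\<close>

lemma null_chain_exists:
  fixes \<Omega> :: "'n::finite minkowski set"
  assumes "open \<Omega>" "connected \<Omega>" "x \<in> \<Omega>" "y \<in> \<Omega>"
  shows "\<exists>L. null_chain \<Omega> T x y L"
proof -
  define S where "S = (\<lambda>y z. y \<in> \<Omega> \<and> z \<in> \<Omega> \<and> (causal_le y z \<or> causal_le z y))"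
  have sym: "S\<^sup>*\<^sup>* b a" if "S\<^sup>*\<^sup>* a b" for a b
    using that by (rule sympD[OF symp_rtranclp, rotated]) (auto simp: S_def intro: sympI)
  have "S\<^sup>*\<^sup>* x y"
  proof (rule connected_equivalence_relation[OF assms(2-4)])
    fix a assume a: "a \<in> \<Omega>"
    obtain e where e: "e > 0" "ball a e \<subseteq> \<Omega>" using assms(1) a open_contains_ball by blast
    define q where "q = a + (e / 2, 0)"
    have "dist a q = e / 2" using e by (simp add: q_def dist_norm norm_Pair)
    then have q: "q \<in> \<Omega>" using e by auto
    \<comment> \<open>From this ball up to \<open>q\<close> the elapsed time is at least
      \<open>e / 4\<close>, the spatial displacement at most \<open>e / 4\<close>.\<close>
    have le: "causal_le z q" if "z \<in> ball a (e / 4)" for z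
    proof -
      have "norm (fst (a - z)) \<le> e / 4" "norm (snd (a - z)) \<le> e / 4"
        using that norm_fst_le[of "fst (a - z)" "snd (a - z)"] norm_snd_le[of "snd (a - z)" "fst (a - z)"]
        unfolding prod.collapse mem_ball dist_norm by linarith+
      then show ?thesis
        using abs_ge_minus_self[of "fst (a - z)"]
        by (simp add: causal_le_iff q_def fcone_def norm_minus_commute)
    qed
    have "S\<^sup>*\<^sup>* a z" if "z \<in> ball a (e / 4)" for z
    proof -
      have "z \<in> \<Omega>" using that e by auto
      then have "S a q" "S q z" using a q le[OF that] le[of a] e by (auto simp: S_def)
      then show ?thesis by auto
    qed
    then show "\<exists>U. openin (top_of_set \<Omega>) U \<and> a \<in> U \<and> (\<forall>z\<in>U. S\<^sup>*\<^sup>* a z)"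
      using e a by (intro exI[of _ "\<Omega> \<inter> ball a (e / 4)"]) auto
  qed (auto intro: sym)
  then show ?thesis
  proof (induction rule: rtranclp_induct)
    case base
    then show ?case using null_chain_refl assms(3) by blast
  next
    case (step y z)
    then show ?case using null_chain_snoc[of \<Omega> T x y _ z] by (auto simp: S_def)
  qed
qed

section \<open>Comparison of the two distances\<close>

lemma proj_lightlike_geodesic_affine:
  assumes "lightlike v" "a < b" "\<And>r. a < r \<Longrightarrow> r < b \<Longrightarrow> x + r *\<^sub>R v \<in> \<Omega>"
  shows "proj_lightlike_geodesic \<Omega> (\<lambda>s. x + ((a + b) / 2 + (b - a) / 2 * s) *\<^sub>R v)"
  unfolding proj_lightlike_geodesic_def
proof (intro exI conjI ballI)
  show "homography_on unit_I (\<lambda>s. (a + b) / 2 + (b - a) / 2 * s)"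
    unfolding homography_on_def
    using assms(2)
    by (intro exI[of _ "(b - a) / 2"] exI[of _ "(a + b) / 2"] exI[of _ 0] exI[of _ 1]) auto
  fix s :: real assume s: "s \<in> unit_I"
  have "(b - a) / 2 * - 1 < (b - a) / 2 * s" "(b - a) / 2 * s < (b - a) / 2 * 1"
    using s assms(2) by (intro mult_strict_left_mono; simp)+
  then show "x + ((a + b) / 2 + (b - a) / 2 * s) *\<^sub>R v \<in> \<Omega>"
    by (intro assms(3)) (simp_all add: field_simps)
qed (use assms in auto)

lemma exists_lightlike: "\<exists>v::'n::finite minkowski. lightlike v"
proof
  show "lightlike ((1, axis undefined 1) :: 'n minkowski)"
    by (simp add: lightlike_def mink_def zero_prod_def inner_axis_axis)
qed

context causal_slab
begin

abbreviation log_ratio :: "'n minkowski \<Rightarrow> real" where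
  "log_ratio \<equiv> \<lambda>z. ln (tau_minus \<Omega> z / tau_plus \<Omega> z)"

lemma log_ratio_le_rho_I:
  assumes "proj_lightlike_geodesic \<Omega> g" "s \<in> unit_I" "t \<in> unit_I"
  shows "\<bar>log_ratio (g t) - log_ratio (g s)\<bar> \<le> rho_I s t"
  by (rule ln_ratio_le_rho_I[where ?f1.0 = "tau_minus \<Omega>" and ?f2.0 = "tau_plus \<Omega>",
        OF tau_minus_star_concave tau_plus_star_concave tau_minus_pos tau_plus_pos assms])

text \<open>A chain has at least one link, so even the trivial one needs a geodesic: a short
  lightlike segment centred at \<open>x\<close>, run from parameter \<open>0\<close> to
  \<open>0\<close>.\<close>

lemma markowitz_chain_refl:
  assumes "x \<in> \<Omega>" shows "markowitz_chain \<Omega> x x 0"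
proof -
  obtain v :: "'n minkowski" where v: "lightlike v" using exists_lightlike by blast
  obtain e where e: "e > 0" "ball x e \<subseteq> \<Omega>" using open_dom assms open_contains_ball by blast
  define k where "k = e / norm v"
  have nv: "norm v > 0" using v by (simp add: lightlike_def)
  have "proj_lightlike_geodesic \<Omega> (\<lambda>s. x + ((- k + k) / 2 + (k - - k) / 2 * s) *\<^sub>R v)"
  proof (rule proj_lightlike_geodesic_affine[OF v])
    show "- k < k" using e nv by (simp add: k_def)
    fix r assume r: "- k < r" "r < k"
    then have "\<bar>r\<bar> * norm v < e" using nv by (simp add: k_def abs_less_iff field_simps)
    then show "x + r *\<^sub>R v \<in> \<Omega>" using e by (auto simp: dist_norm)
  qed
  from markowitz_chain_single[OF this, of 0 0] show ?thesis by (simp add: rho_I_def)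
qed

text \<open>The parameters of the points of the line in \<open>\<Omega>\<close> form an open set,
  which is an interval by \<open>diamond\<close> and bounded by the time bounds; openness excludes
  its infimum and supremum.\<close>

lemma maximal_lightlike_segment:
  assumes x: "x \<in> \<Omega>" and y: "x + v \<in> \<Omega>" and v: "lightlike v" "v \<in> fcone"
  obtains a b where "a < 0" "1 < b" "x + a *\<^sub>R v \<notin> \<Omega>" "x + b *\<^sub>R v \<notin> \<Omega>"
    "\<And>r. a < r \<Longrightarrow> r < b \<Longrightarrow> x + r *\<^sub>R v \<in> \<Omega>"
proof -
  define R where "R = {r. x + r *\<^sub>R v \<in> \<Omega>}"
  \<comment> \<open>Converts bounds on elapsed time into bounds on the line parameter.\<close>
  have v0: "fst v > 0"
    using v by (auto simp: lightlike_def mink_eq_0_iff fcone_def prod_eq_iff)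
      (metis norm_eq_zero norm_ge_zero order_antisym_conv not_le order_trans)
  have openR: "open R"
  proof -
    have "R = (\<lambda>r. x + r *\<^sub>R v) -` \<Omega>" by (auto simp: R_def)
    then show ?thesis using open_dom by (auto intro!: open_vimage continuous_intros)
  qed
  have ivl: "r \<in> R" if "p \<in> R" "q \<in> R" "p \<le> r" "r \<le> q" for p q r
  proof -
    have "x + r *\<^sub>R v - (x + p *\<^sub>R v) = (r - p) *\<^sub>R v" "x + q *\<^sub>R v - (x + r *\<^sub>R v) = (q - r) *\<^sub>R v"
      by (simp_all add: scaleR_diff_left)
    then have "x + r *\<^sub>R v - (x + p *\<^sub>R v) \<in> fcone" "x + q *\<^sub>R v - (x + r *\<^sub>R v) \<in> fcone"
      using that(3,4) by (simp_all only: fcone_scale[OF v(2)] diff_ge_0_iff_ge)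
    then show ?thesis using that(1,2) diamond unfolding R_def by blast
  qed
  have R01: "0 \<in> R" "1 \<in> R" using x y by (auto simp: R_def)
  obtain K where K: "\<forall>y\<in>\<Omega>. y - x \<in> fcone \<longrightarrow> fst y - fst x \<le> K" using future_bounded[OF x] by blast
  have above: "bdd_above R"
  proof (rule bdd_aboveI)
    fix r assume r: "r \<in> R"
    show "r \<le> max 0 (K / fst v)"
    proof (cases "r \<ge> 0")
      case True
      then have "r * fst v \<le> K" using K r v fcone_scale[of v r] by (auto simp: R_def)
      then show ?thesis using v0 by (simp add: field_simps le_max_iff_disj)
    qed auto
  qed
  obtain K' where K': "\<forall>y\<in>\<Omega>. x - y \<in> fcone \<longrightarrow> fst x - fst y \<le> K'" using past_bounded[OF x] by blast
  have below: "bdd_below R"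
  proof (rule bdd_belowI)
    fix r assume r: "r \<in> R"
    show "- max 0 (K' / fst v) \<le> r"
    proof (cases "r \<le> 0")
      case True
      then have "- r * fst v \<le> K'" using K' r v fcone_scale[of v "- r"] by (auto simp: R_def)
      then have "- r \<le> K' / fst v" using v0 by (simp add: pos_le_divide_eq)
      then show ?thesis by linarith
    qed auto
  qed
  have a_notin: "Inf R \<notin> R"
  proof
    assume "Inf R \<in> R"
    then obtain e where e: "e > 0" "cball (Inf R) e \<subseteq> R" using openR open_contains_cball by blast
    then have "Inf R - e \<in> R" by (auto simp: dist_norm)
    then show False using cInf_lower[OF _ below] e by fastforce
  qed
  have b_notin: "Sup R \<notin> R"
  proof
    assume "Sup R \<in> R"
    then obtain e where e: "e > 0" "cball (Sup R) e \<subseteq> R" using openR open_contains_cball by blast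
    then have "Sup R + e \<in> R" by (auto simp: dist_norm)
    then show False using cSup_upper[OF _ above] e by fastforce
  qed
  show ?thesis
  proof
    show "Inf R < 0" using cInf_lower[OF R01(1) below] a_notin R01 by (metis order_le_less)
    show "1 < Sup R" using cSup_upper[OF R01(2) above] b_notin R01 by (metis order_le_less)
    show "x + Inf R *\<^sub>R v \<notin> \<Omega>" "x + Sup R *\<^sub>R v \<notin> \<Omega>"
      using a_notin b_notin by (auto simp: R_def)
    fix r assume r: "Inf R < r" "r < Sup R"
    obtain p where p: "p \<in> R" "p < r" using r(1) cInf_less_iff[OF _ below] R01 by blast
    obtain q where q: "q \<in> R" "r < q" using r(2) less_cSup_iff[OF _ above] R01 by blast
    have "r \<in> R" using ivl[OF p(1) q(1)] p q by simp
    then show "x + r *\<^sub>R v \<in> \<Omega>" by (simp add: R_def)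
  qed
qed

text \<open>On the maximal segment, \<open>tau_minus_growth\<close> at the lower end and
  \<open>tau_plus_growth\<close> at the upper end bound the two factors of the cross-ratio by
  squares of quotients of cosmological times; the squares produce the factor 2.\<close>

lemma lightlike_step:
  assumes x: "x \<in> \<Omega>" and y: "x + v \<in> \<Omega>" and v: "v \<in> fcone" "mink v v = 0"
  obtains g s t where "proj_lightlike_geodesic \<Omega> g" "s \<in> unit_I" "t \<in> unit_I"
    "g s = x" "g t = x + v" "rho_I s t \<le> 2 * (log_ratio (x + v) - log_ratio x)"
proof (cases "v = 0")
  case True
  \<comment> \<open>The zero vector spans no line; the first geodesic of a trivial chain passes
    through \<open>x\<close>.\<close>
  from markowitz_chain_refl[OF x] obtain g :: "real \<Rightarrow> 'n minkowski" and s where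
    "proj_lightlike_geodesic \<Omega> g" "s \<in> unit_I" "g s = x"
    unfolding markowitz_chain_def by (metis atLeastAtMost_iff order_refl)
  then show ?thesis using that[of g s s] True by (simp add: rho_I_def)
next
  case False
  then have ll: "lightlike v" using v by (simp add: lightlike_def)
  obtain a b where ab: "a < 0" "1 < b" "x + a *\<^sub>R v \<notin> \<Omega>" "x + b *\<^sub>R v \<notin> \<Omega>"
    "\<And>r. a < r \<Longrightarrow> r < b \<Longrightarrow> x + r *\<^sub>R v \<in> \<Omega>"
    using maximal_lightlike_segment[OF x y ll v(1)] by metis
  \<comment> \<open>\<open>s\<close> and \<open>t\<close> are the parameters at which the
    coefficient of \<open>v\<close> in \<open>g\<close> takes the values \<open>0\<close> and
    \<open>1\<close>.\<close>
  define s where "s = - (a + b) / (b - a)"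
  define t where "t = (2 - a - b) / (b - a)"
  define g where "g = (\<lambda>s. x + ((a + b) / 2 + (b - a) / 2 * s) *\<^sub>R v)"
  have ba: "b - a > 0" using ab by simp
  have st: "s \<in> unit_I" "t \<in> unit_I" using ab ba by (auto simp: s_def t_def field_simps)
  have gs: "g s = x"
  proof -
    have "(a + b) / 2 + (b - a) / 2 * s = 0" using ba by (simp add: s_def) (simp add: field_simps)
    then show ?thesis unfolding g_def by simp
  qed
  have gt: "g t = x + v"
  proof -
    have "(a + b) / 2 + (b - a) / 2 * t = 1" using ba by (simp add: t_def) (simp add: field_simps)
    then show ?thesis unfolding g_def by simp
  qed
  define k where "k = 2 / (b - a)"
  have k: "k \<noteq> 0" using ba by (simp add: k_def)
  have "t + 1 = k * (1 - a)" "s + 1 = k * (- a)" "1 - s = k * b" "1 - t = k * (b - 1)"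
    using ba by (auto simp: s_def t_def k_def field_simps)
  then have e1: "(t + 1) / (s + 1) = (1 - a) / (- a)" and e2: "(1 - s) / (1 - t) = b / (b - 1)"
    by (simp_all only: mult_divide_mult_cancel_left[OF k])
  note p = tau_minus_pos[OF x] tau_minus_pos[OF y] tau_plus_pos[OF x] tau_plus_pos[OF y]
  \<comment> \<open>In units of \<open>v\<close>, the excluded point is \<open>-a\<close> below
    \<open>x\<close> and the step has length \<open>1\<close>.\<close>
  have "(- a + 1) * (tau_minus \<Omega> x)\<^sup>2 \<le> - a * (tau_minus \<Omega> (x + 1 *\<^sub>R v))\<^sup>2"
    by (rule tau_minus_growth) (use x y v ab in auto)
  then have "(1 - a) / (- a) \<le> (tau_minus \<Omega> (x + v) / tau_minus \<Omega> x)\<^sup>2"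
    using p ab by (simp add: power_divide field_simps)
  then have "ln ((1 - a) / (- a)) \<le> ln ((tau_minus \<Omega> (x + v) / tau_minus \<Omega> x)\<^sup>2)"
    using ab by (intro ln_mono) (auto simp: divide_simps)
  then have 1: "ln ((1 - a) / (- a)) \<le> 2 * (ln (tau_minus \<Omega> (x + v)) - ln (tau_minus \<Omega> x))"
    using p by (simp add: ln_realpow ln_div)
  have "x + v + (b - 1) *\<^sub>R v = x + b *\<^sub>R v" by (simp add: algebra_simps)
  then have "x + v + (b - 1) *\<^sub>R v \<notin> \<Omega>" using ab(4) by (simp only:) simp
  \<comment> \<open>Dually, the excluded point is \<open>b - 1\<close> above
    \<open>x + v\<close>.\<close>
  then have "((b - 1) + 1) * (tau_plus \<Omega> (x + v))\<^sup>2 \<le> (b - 1) * (tau_plus \<Omega> (x + v - 1 *\<^sub>R v))\<^sup>2"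
    using x y v ab(2) by (intro tau_plus_growth) simp_all
  then have "b / (b - 1) \<le> (tau_plus \<Omega> x / tau_plus \<Omega> (x + v))\<^sup>2"
    using p ab by (simp add: power_divide field_simps)
  then have "ln (b / (b - 1)) \<le> ln ((tau_plus \<Omega> x / tau_plus \<Omega> (x + v))\<^sup>2)"
    using ab by (intro ln_mono) auto
  then have 2: "ln (b / (b - 1)) \<le> 2 * (ln (tau_plus \<Omega> x) - ln (tau_plus \<Omega> (x + v)))"
    using p by (simp add: ln_realpow ln_div)
  \<comment> \<open>Nonnegativity of both logarithms removes the absolute value in
    \<open>rho_I_eq\<close>.\<close>
  have "0 \<le> ln ((1 - a) / (- a))" "0 \<le> ln (b / (b - 1))"
    using ab by (auto intro!: ln_ge_zero simp: divide_simps)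
  then have "rho_I s t \<le> 2 * (log_ratio (x + v) - log_ratio x)"
    unfolding rho_I_eq[OF st] e1 e2 using 1 2 p by (simp add: ln_div)
  moreover have "proj_lightlike_geodesic \<Omega> g"
    unfolding g_def using ll ab by (intro proj_lightlike_geodesic_affine) auto
  ultimately show ?thesis using that st gs gt by blast
qed

text \<open>The summands are the components of \<open>v\<close> along the two null directions of the plane
  spanned by \<open>v\<close> and \<open>\<partial>\<^sub>t\<close>.\<close>

lemma fcone_lightlike_sum:
  fixes v :: "'n minkowski"
  assumes "v \<in> fcone"
  obtains u w where "v = u + w" "u \<in> fcone" "w \<in> fcone" "mink u u = 0" "mink w w = 0"
proof -
  have v: "norm (snd v) \<le> fst v" using assms by (simp add: fcone_def)
  obtain e where e: "norm e = 1" "snd v = norm (snd v) *\<^sub>R e"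
  proof (cases "snd v = 0")
    case True
    \<comment> \<open>Any unit vector serves when \<open>v\<close> has no spatial part.\<close>
    then show ?thesis using that[of "axis undefined 1"] by simp
  next
    case False
    then show ?thesis using that[of "sgn (snd v)"] by (simp add: sgn_div_norm)
  qed
  define p where "p = (fst v + norm (snd v)) / 2"
  define q where "q = (fst v - norm (snd v)) / 2"
  have pq: "p \<ge> 0" "q \<ge> 0" "p + q = fst v" "p - q = norm (snd v)"
    using v order_trans[OF norm_ge_zero v] by (auto simp: p_def q_def field_simps add_nonneg_nonneg)
  have "snd v = p *\<^sub>R e - q *\<^sub>R e"
    using e(2) pq(4) by (simp add: scaleR_diff_left[symmetric])
  then have "v = (p, p *\<^sub>R e) + (q, - (q *\<^sub>R e))"
    using pq by (simp add: prod_eq_iff)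
  moreover have "(p, p *\<^sub>R e) \<in> fcone" "(q, - (q *\<^sub>R e)) \<in> fcone"
    "mink (p, p *\<^sub>R e) (p, p *\<^sub>R e) = 0" "mink (q, - (q *\<^sub>R e)) (q, - (q *\<^sub>R e)) = 0"
    using pq(1,2) e(1) by (simp_all add: fcone_def mink_eq_0_iff)
  ultimately show ?thesis by (rule that)
qed

text \<open>A causal step splits into two lightlike ones whose common point stays in
  \<open>\<Omega>\<close> by \<open>diamond\<close>, and their bounds telescope, being differences
  of \<open>log_ratio\<close>. A past-directed step runs through such a pair of geodesics
  backwards.\<close>

lemma markowitz_chain_causal_snoc:
  assumes ch: "markowitz_chain \<Omega> x0 p L" and "p \<in> \<Omega>" "q \<in> \<Omega>" "causal_le p q \<or> causal_le q p"
  shows "\<exists>L'. markowitz_chain \<Omega> x0 q L' \<and> L' \<le> L + 2 * \<bar>log_ratio q - log_ratio p\<bar>"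
proof -
  have split: "\<exists>g1 s1 t1 g2 s2 t2. proj_lightlike_geodesic \<Omega> g1 \<and> proj_lightlike_geodesic \<Omega> g2 \<and>
      {s1, t1, s2, t2} \<subseteq> unit_I \<and> g1 s1 = x \<and> g1 t1 = g2 s2 \<and> g2 t2 = y \<and>
      rho_I s1 t1 + rho_I s2 t2 \<le> 2 * (log_ratio y - log_ratio x)"
    if xy: "x \<in> \<Omega>" "y \<in> \<Omega>" "causal_le x y" for x y
  proof -
    obtain u w where uw: "y - x = u + w" "u \<in> fcone" "w \<in> fcone" "mink u u = 0" "mink w w = 0"
      using fcone_lightlike_sum xy(3) by (metis causal_le_iff)
    have y: "y = x + u + w" using uw(1) by (simp add: algebra_simps)
    have z: "x + u \<in> \<Omega>" by (rule diamond[OF xy(1,2)]) (simp_all add: y uw(2,3))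
    obtain g1 s1 t1 where 1: "proj_lightlike_geodesic \<Omega> g1" "s1 \<in> unit_I" "t1 \<in> unit_I"
      "g1 s1 = x" "g1 t1 = x + u" "rho_I s1 t1 \<le> 2 * (log_ratio (x + u) - log_ratio x)"
      by (rule lightlike_step[OF xy(1) z uw(2,4)])
    obtain g2 s2 t2 where 2: "proj_lightlike_geodesic \<Omega> g2" "s2 \<in> unit_I" "t2 \<in> unit_I"
      "g2 s2 = x + u" "g2 t2 = y" "rho_I s2 t2 \<le> 2 * (log_ratio y - log_ratio (x + u))"
      unfolding y by (rule lightlike_step[OF z xy(2)[unfolded y] uw(3,5)])
    show ?thesis
      by (intro exI[of _ g1] exI[of _ s1] exI[of _ t1] exI[of _ g2] exI[of _ s2] exI[of _ t2])
        (use 1 2 in auto)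
  qed
  have est: "L + a + b \<le> L + 2 * \<bar>d\<bar>" "L + b + a \<le> L + 2 * \<bar>d\<bar>" if "a + b \<le> 2 * d" for a b d :: real
    using that by linarith+
  show ?thesis
    using assms(4)
  proof
    assume "causal_le p q"
    from split[OF assms(2,3) this] obtain g1 s1 t1 g2 s2 t2 where
      *: "proj_lightlike_geodesic \<Omega> g1" "proj_lightlike_geodesic \<Omega> g2"
      "{s1, t1, s2, t2} \<subseteq> unit_I" "g1 s1 = p" "g1 t1 = g2 s2" "g2 t2 = q"
      "rho_I s1 t1 + rho_I s2 t2 \<le> 2 * (log_ratio q - log_ratio p)" by blast
    have "markowitz_chain \<Omega> x0 (g2 s2) (L + rho_I s1 t1)"
      using markowitz_chain_snoc[of \<Omega> x0 g1 s1 L t1] ch * by simp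
    then have "markowitz_chain \<Omega> x0 q (L + rho_I s1 t1 + rho_I s2 t2)"
      using markowitz_chain_snoc[of \<Omega> x0 g2 s2 _ t2] * by auto
    moreover have "L + rho_I s1 t1 + rho_I s2 t2 \<le> L + 2 * \<bar>log_ratio q - log_ratio p\<bar>"
      using *(7) by (rule est(1))
    ultimately show ?thesis by blast
  next
    assume "causal_le q p"
    from split[OF assms(3,2) this] obtain g1 s1 t1 g2 s2 t2 where
      *: "proj_lightlike_geodesic \<Omega> g1" "proj_lightlike_geodesic \<Omega> g2"
      "{s1, t1, s2, t2} \<subseteq> unit_I" "g1 s1 = q" "g1 t1 = g2 s2" "g2 t2 = p"
      "rho_I s1 t1 + rho_I s2 t2 \<le> 2 * (log_ratio p - log_ratio q)" by blast
    have "markowitz_chain \<Omega> x0 (g1 t1) (L + rho_I t2 s2)"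
      using markowitz_chain_snoc[of \<Omega> x0 g2 t2 L s2] ch * by simp
    then have "markowitz_chain \<Omega> x0 q (L + rho_I t2 s2 + rho_I t1 s1)"
      using markowitz_chain_snoc[of \<Omega> x0 g1 t1 _ s1] * by auto
    moreover have comm: "rho_I t2 s2 = rho_I s2 t2" "rho_I t1 s1 = rho_I s1 t1"
      using * by (auto intro!: rho_I_commute)
    have "L + rho_I t2 s2 + rho_I t1 s1 \<le> L + 2 * \<bar>log_ratio q - log_ratio p\<bar>"
      unfolding comm abs_minus_commute[of "log_ratio q"] using *(7) by (rule est(2))
    ultimately show ?thesis by blast
  qed
qed

lemma markowitz_chain_of_null_chain:
  assumes "null_chain \<Omega> log_ratio x y L"
  shows "\<exists>L'. markowitz_chain \<Omega> x y L' \<and> L' \<le> 2 * L"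
  using assms
proof (induction rule: null_chain_induct)
  case refl
  then show ?case using markowitz_chain_refl by (intro exI[of _ 0]) simp
next
  case (snoc y z L)
  then obtain L' where L': "markowitz_chain \<Omega> x y L'" "L' \<le> 2 * L" by blast
  from markowitz_chain_causal_snoc[OF L'(1) snoc(2-4)] L'(2) show ?case by (smt (verit))
qed

text \<open>Two points of a lightlike geodesic are causally related, so the junctions of a chain
  form a null chain; \<open>log_ratio_le_rho_I\<close> compares the lengths link by link.\<close>

lemma null_chain_of_markowitz_chain:
  assumes "markowitz_chain \<Omega> x y L"
  shows "\<exists>L'. null_chain \<Omega> log_ratio x y L' \<and> L' \<le> L"
proof -
  obtain m g s t where m: "L = (\<Sum>k\<in>{1..m}. rho_I (s k) (t k))" "m \<ge> (1::nat)"
     "\<And>k. k\<in>{1..m} \<Longrightarrow> proj_lightlike_geodesic \<Omega> (g k) \<and> s k \<in> unit_I \<and> t k \<in> unit_I"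
     "g 1 (s 1) = x" "g m (t m) = y"
     "\<And>k. k\<in>{1..<m} \<Longrightarrow> g k (t k) = g (k + 1) (s (k + 1))"
    using assms unfolding markowitz_chain_def by blast
  have inO: "g k r \<in> \<Omega>" if "k \<in> {1..m}" "r \<in> unit_I" for k r
    using m(3)[OF that(1)] that(2) unfolding proj_lightlike_geodesic_def by blast
  have rel: "causal_le (g k (s k)) (g k (t k)) \<or> causal_le (g k (t k)) (g k (s k))"
    if k: "k \<in> {1..m}" for k
  proof -
    obtain x v h where xvh: "lightlike v" "\<forall>r\<in>unit_I. g k r = x + h r *\<^sub>R v \<and> g k r \<in> \<Omega>"
      using m(3)[OF k] unfolding proj_lightlike_geodesic_def by blast
    have d: "g k (t k) - g k (s k) = (h (t k) - h (s k)) *\<^sub>R v"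
      "g k (s k) - g k (t k) = (h (s k) - h (t k)) *\<^sub>R v"
      using xvh(2) m(3)[OF k] by (auto simp: algebra_simps)
    have e: "c *\<^sub>R v \<in> fcone \<or> (- c) *\<^sub>R v \<in> fcone" for c
    proof (cases "v \<in> fcone")
      case True
      then show ?thesis using fcone_scale[of v c] fcone_scale[of v "- c"] by linarith
    next
      case False
      then have "- v \<in> fcone" using lightlike_fcone_cases xvh(1) by blast
      then show ?thesis using fcone_scale[of "- v" c] fcone_scale[of "- v" "- c"] by force
    qed
    show ?thesis unfolding causal_le_iff d using e[of "h (t k) - h (s k)"] by simp
  qed
  have "\<exists>L'. null_chain \<Omega> log_ratio x (g j (t j)) L' \<and> L' \<le> (\<Sum>k\<in>{1..j}. rho_I (s k) (t k))"
    if "1 \<le> j" "j \<le> m" for j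
    using that
  proof (induction j)
    case (Suc j)
    have j: "Suc j \<in> {1..m}" using Suc.prems by simp
    have start: "\<exists>L'. null_chain \<Omega> log_ratio x (g (Suc j) (s (Suc j))) L' \<and>
        L' \<le> (\<Sum>k\<in>{1..j}. rho_I (s k) (t k))"
    proof (cases "j = 0")
      case True
      then show ?thesis using null_chain_refl[of x \<Omega> log_ratio] m(2-4) inO[of 1 "s 1"] by auto
    next
      case False
      then show ?thesis using Suc m(6)[of j] by simp
    qed
    then obtain L' where L': "null_chain \<Omega> log_ratio x (g (Suc j) (s (Suc j))) L'"
      "L' \<le> (\<Sum>k\<in>{1..j}. rho_I (s k) (t k))" by blast
    have "null_chain \<Omega> log_ratio x (g (Suc j) (t (Suc j)))
        (L' + \<bar>log_ratio (g (Suc j) (t (Suc j))) - log_ratio (g (Suc j) (s (Suc j)))\<bar>)"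
      using rel[OF j] m(3)[OF j] by (intro null_chain_snoc[OF L'(1)] inO[OF j]) auto
    moreover have "\<bar>log_ratio (g (Suc j) (t (Suc j))) - log_ratio (g (Suc j) (s (Suc j)))\<bar>
        \<le> rho_I (s (Suc j)) (t (Suc j))"
      using m(3)[OF j] by (intro log_ratio_le_rho_I) auto
    ultimately show ?case using L'(2)
      by (intro exI[of _ "L' + \<bar>log_ratio (g (Suc j) (t (Suc j))) - log_ratio (g (Suc j) (s (Suc j)))\<bar>"])
        simp
  qed simp
  then show ?thesis using m by blast
qed

section \<open>Passage to the infima\<close>

lemma null_distance_le_markowitz_dist:
  assumes "x \<in> \<Omega>" "y \<in> \<Omega>"
  shows "null_distance \<Omega> log_ratio x y \<le> markowitz_dist \<Omega> x y"
  unfolding markowitz_dist_eq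
proof (rule cInf_greatest)
  \<comment> \<open>Existence of a Markowitz chain comes from converting a null chain.\<close>
  obtain L where "null_chain \<Omega> log_ratio x y L"
    using null_chain_exists[OF open_dom convex_connected[OF convex_dom] assms] by blast
  then show "{L. markowitz_chain \<Omega> x y L} \<noteq> {}"
    using markowitz_chain_of_null_chain by blast
  fix L assume "L \<in> {L. markowitz_chain \<Omega> x y L}"
  then show "null_distance \<Omega> log_ratio x y \<le> L"
    using null_chain_of_markowitz_chain null_distance_le order_trans by (metis mem_Collect_eq)
qed

lemma markowitz_dist_le_null_distance:
  assumes "x \<in> \<Omega>" "y \<in> \<Omega>"
  shows "markowitz_dist \<Omega> x y \<le> 2 * null_distance \<Omega> log_ratio x y"
proof -
  have "markowitz_dist \<Omega> x y / 2 \<le> null_distance \<Omega> log_ratio x y"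
    unfolding null_distance_eq
  proof (rule cInf_greatest)
    show "{L. null_chain \<Omega> log_ratio x y L} \<noteq> {}"
      using null_chain_exists[OF open_dom convex_connected[OF convex_dom] assms] by blast
    fix L assume "L \<in> {L. null_chain \<Omega> log_ratio x y L}"
    then show "markowitz_dist \<Omega> x y / 2 \<le> L"
      using markowitz_chain_of_null_chain markowitz_dist_le by fastforce
  qed
  then show ?thesis by simp
qed

text \<open>Allows the factor \<open>1 / 2\<close> to be inserted into the sharper bound
  \<open>null_distance_le_markowitz_dist\<close>.\<close>

lemma null_distance_nonneg:
  assumes "x \<in> \<Omega>" "y \<in> \<Omega>"
  shows "0 \<le> null_distance \<Omega> log_ratio x y"
  unfolding null_distance_eq
proof (rule cInf_greatest)
  show "{L. null_chain \<Omega> log_ratio x y L} \<noteq> {}"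
    using null_chain_exists[OF open_dom convex_connected[OF convex_dom] assms] by blast
qed (auto dest: null_chain_nonneg)

end

section \<open>Slabs between spacelike hyperplanes\<close>

text \<open>Were the Euclidean normal not timelike, the hyperplane would have a direction that is
  not spacelike. The sign of \<open>a\<close> is chosen so that it pairs nonnegatively with
  \<open>fcone\<close>.\<close>

lemma spacelike_hyperplane_normal:
  fixes H :: "'n::finite minkowski set"
  assumes "spacelike_hyperplane H"
  obtains a c where "H = {x. a \<bullet> x = c}" "norm (snd a) < fst a"
proof -
  obtain a c where a: "a \<noteq> 0" "H = {x. a \<bullet> x = c}"
    and pos: "\<And>x y. x \<in> H \<Longrightarrow> y \<in> H \<Longrightarrow> x - y \<noteq> 0 \<Longrightarrow> mink (x - y) (x - y) > 0"
    using assms unfolding spacelike_hyperplane_def by blast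
  have lt: "norm (snd a) < \<bar>fst a\<bar>"
  proof (cases "snd a = 0")
    case True
    then show ?thesis using a(1) by (auto simp: prod_eq_iff)
  next
    case False
    \<comment> \<open>A direction of \<open>H\<close> in the plane spanned by \<open>snd a\<close>
      and the time axis; the sign of \<open>mink v v\<close> is that of
      \<open>(fst a)\<^sup>2 - (norm (snd a))\<^sup>2\<close>.\<close>
    define v where "v = ((norm (snd a))\<^sup>2, - fst a *\<^sub>R snd a)"
    define y where "y = (c / (a \<bullet> a)) *\<^sub>R a"
    have y: "y \<in> H" using a by (simp add: y_def)
    have "a \<bullet> v = 0" by (simp add: v_def inner_prod_def power2_norm_eq_inner)
    then have "y + v \<in> H" using y a(2) by (simp add: inner_add_right)
    moreover have "v \<noteq> 0" using False by (simp add: v_def zero_prod_def)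
    ultimately have "mink v v > 0" using pos[of "y + v" y] y by simp
    then have "0 < (norm (snd a))\<^sup>2 * ((fst a)\<^sup>2 - (norm (snd a))\<^sup>2)"
      by (simp add: v_def mink_self power_mult_distrib algebra_simps)
    then have "(norm (snd a))\<^sup>2 < (fst a)\<^sup>2" using False by (simp add: zero_less_mult_iff)
    then show ?thesis using mink_less_0_iff[of a] by (simp add: mink_self)
  qed
  show ?thesis
  proof (cases "fst a \<ge> 0")
    case True
    then show ?thesis using that[of a c] a lt by simp
  next
    case False
    have "H = {x. (- a) \<bullet> x = - c}" using a by auto
    then show ?thesis using that[of "- a" "- c"] lt False by simp
  qed
qed

text \<open>Cauchy-Schwarz on the spatial part. When the factor on the left is positive, the
  functional given by \<open>a\<close> controls the elapsed time.\<close>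

lemma inner_fcone_ge:
  assumes "w \<in> fcone"
  shows "(fst a - norm (snd a)) * fst w \<le> a \<bullet> w"
proof -
  have "- (snd a \<bullet> snd w) \<le> norm (snd a) * norm (snd w)"
    using Cauchy_Schwarz_ineq2[of "snd a" "snd w"] by linarith
  also have "\<dots> \<le> norm (snd a) * fst w"
    using assms by (intro mult_left_mono) (auto simp: fcone_def)
  finally show ?thesis by (simp add: inner_prod_def algebra_simps)
qed

text \<open>\<open>diamond\<close> is causal convexity for a curve broken at \<open>z\<close>. For
  the time bounds, the normal functional of each hyperplane is monotone in the causal order, hence
  bounded on one side on \<open>\<Omega>\<close>, and \<open>inner_fcone_ge\<close> converts this
  into a bound on elapsed time.\<close>

lemma causal_slab_between:
  fixes \<Omega> :: "'n::finite minkowski set"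
  assumes "open \<Omega>" "convex \<Omega>" "causally_convex \<Omega>" "between_spacelike_hyperplanes \<Omega>"
  shows "causal_slab \<Omega>"
proof
  fix x y z assume A: "x \<in> \<Omega>" "y \<in> \<Omega>" "z - x \<in> fcone" "y - z \<in> fcone"
  show "z \<in> \<Omega>"
  \<comment> \<open>Velocities of causal curves are nonzero, so degenerate segments are set
    apart.\<close>
  proof (cases "x = z \<or> z = y")
    case False
    define c where "c = (\<lambda>s. if s \<le> 1 then x + s *\<^sub>R (z - x) else z + (s - 1) *\<^sub>R (y - z))"
    have "causal_curve c 0 2"
      unfolding c_def causal_curve_def
      using False A by (intro disjI1 future_causal_curve_broken_line) auto
    moreover have "c 0 \<in> \<Omega>" "c 2 \<in> \<Omega>" using A by (auto simp: c_def)
    ultimately have "c ` {0..2} \<subseteq> \<Omega>" using assms(3) unfolding causally_convex_def by blast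
    moreover have "c 1 = z" by (simp add: c_def)
    ultimately show ?thesis by force
  qed (use A in auto)
next
  obtain H1 H2 where H: "spacelike_hyperplane H1" "spacelike_hyperplane H2"
    "\<Omega> \<subseteq> (\<Union>x\<in>H1. J_plus x)" "\<Omega> \<subseteq> (\<Union>x\<in>H2. J_minus x)"
    using assms(4) unfolding between_spacelike_hyperplanes_def by blast
  have nonneg: "0 \<le> a \<bullet> w" if "w \<in> fcone" "norm (snd a) < fst a" for a w :: "'n minkowski"
  proof -
    have "0 \<le> fst w" using that order_trans[OF norm_ge_zero] by (auto simp: fcone_def)
    then have "0 \<le> (fst a - norm (snd a)) * fst w" using that by simp
    then show ?thesis using inner_fcone_ge[OF that(1), of a] by linarith
  qed
  fix x assume x: "x \<in> \<Omega>"
  obtain a c where a: "H1 = {x. a \<bullet> x = c}" "norm (snd a) < fst a"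
    using spacelike_hyperplane_normal[OF H(1)] by metis
  have low: "c \<le> a \<bullet> y" if y: "y \<in> \<Omega>" for y
  proof -
    obtain h where "h \<in> H1" "y \<in> J_plus h" using H(3) y by blast
    then have h: "a \<bullet> h = c" "y - h \<in> fcone" by (simp_all add: a(1) J_plus_def causal_le_iff)
    then show ?thesis using nonneg[OF h(2) a(2)] by (simp add: inner_diff_right)
  qed
  have "fst x - fst y \<le> (a \<bullet> x - c) / (fst a - norm (snd a))" if "y \<in> \<Omega>" "x - y \<in> fcone" for y
    using inner_fcone_ge[OF that(2), of a] low[OF that(1)] a(2)
    by (simp add: inner_diff_right pos_le_divide_eq mult.commute)
  then show "\<exists>K. \<forall>y\<in>\<Omega>. x - y \<in> fcone \<longrightarrow> fst x - fst y \<le> K" by blast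
  obtain b d where b: "H2 = {x. b \<bullet> x = d}" "norm (snd b) < fst b"
    using spacelike_hyperplane_normal[OF H(2)] by metis
  have up: "b \<bullet> y \<le> d" if y: "y \<in> \<Omega>" for y
  proof -
    obtain h where "h \<in> H2" "y \<in> J_minus h" using H(4) y by blast
    then have h: "b \<bullet> h = d" "h - y \<in> fcone" by (simp_all add: b(1) J_minus_def causal_le_iff)
    then show ?thesis using nonneg[OF h(2) b(2)] by (simp add: inner_diff_right)
  qed
  have "fst y - fst x \<le> (d - b \<bullet> x) / (fst b - norm (snd b))" if "y \<in> \<Omega>" "y - x \<in> fcone" for y
    using inner_fcone_ge[OF that(2), of b] up[OF that(1)] b(2)
    by (simp add: inner_diff_right pos_le_divide_eq mult.commute)
  then show "\<exists>K. \<forall>y\<in>\<Omega>. y - x \<in> fcone \<longrightarrow> fst y - fst x \<le> K" by blast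
qed (use assms in auto)

theorem theorem6p11:
  fixes \<Omega> :: "'n::finite minkowski set"
  assumes "mink_domain \<Omega>"
    and "convex \<Omega>"
    and "causally_convex \<Omega>"
    and "between_spacelike_hyperplanes \<Omega>"
  shows "\<forall>x\<in>\<Omega>. \<forall>y\<in>\<Omega>.
    1 / 2 * null_distance \<Omega> (\<lambda>z. ln (tau_minus \<Omega> z / tau_plus \<Omega> z)) x y \<le> markowitz_dist \<Omega> x y \<and>
    markowitz_dist \<Omega> x y \<le> 2 * null_distance \<Omega> (\<lambda>z. ln (tau_minus \<Omega> z / tau_plus \<Omega> z)) x y"
proof -
  interpret causal_slab \<Omega>
    using assms by (intro causal_slab_between) (auto simp: mink_domain_def)
  show ?thesis
  proof (intro ballI conjI)
    fix x y assume xy: "x \<in> \<Omega>" "y \<in> \<Omega>"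
    show "1 / 2 * null_distance \<Omega> log_ratio x y \<le> markowitz_dist \<Omega> x y"
      using null_distance_le_markowitz_dist[OF xy] null_distance_nonneg[OF xy] by linarith
    show "markowitz_dist \<Omega> x y \<le> 2 * null_distance \<Omega> log_ratio x y"
      using markowitz_dist_le_null_distance[OF xy] .
  qed
qed

end
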